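(* Let $N,T$ be integers with $N\ge T\ge 500$, let $\mu=0\in\mathbb{R}^N$ and let $\Sigma\in\mathbb{R}^{N\times N}$ be symmetric positive semidefinite. Let $F=(F_n)_{n\in[N]}\sim\mathcal N(0,\Sigma)$, $\hat F:=\max_{n\in[N]}F_n$, with $\mathbb{E}[\hat F]\ne0$. If the actions $A_1,\dots,A_T$ are chosen by following either the EI2 strategy or the UCB2 strategy, then, with $\hat Y:=\max_{t\in[T]}Y_t$, $$\frac{\mathbb{E}[\hat F]-\mathbb{E}[\hat Y]}{\mathbb{E}[\hat F]}\le 1-\left(1-T^{-\frac{1}{2\sqrt{\pi}}}\right)\sqrt{\frac{\log(T)-\log\left(3\log^{\frac32}(T)\right)}{\log(N)}}.$$
   Context: Setting: $[N]=\{1,\dots,N\}$. An unknown function $F=(F_n)_{n\in[N]}$ has Gaussian prior $\mathcal N(\mu,\Sigma)$. For $t=1,\dots,T$ an agent picks an action $A_t\in[N]$ based only on past actions and observations $A_{:t-1},Y_{:t-1}$ (and the known prior), and observes without noise $Y_t:=F_{A_t}$. The posterior mean and covariance are $M_t:=\mathbb{E}[F\mid A_{:t},Y_{:t}]\in\mathbb{R}^N$ and $C_t:=\mathrm{Cov}[F\mid A_{:t},Y_{:t}]$, with entries $M_t^n$ and $C_t^{nn}$. Set $\hat Y_t:=\max_{k\in[t]}Y_k$, $\check Y_t:=\min_{k\in[t]}Y_k$. Expected improvement: for $\sigma>0$, $\mathrm{ei}(\tau|\mu,\sigma)=\int_{-\infty}^\infty\max\{x-\tau,0\}\,\mathcal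 N(x|\mu,\sigma)\,dx$, where $\mathcal N(\cdot|\mu,\sigma)$ is the normal density with mean $\mu$ and standard deviation $\sigma$; for $\sigma=0$, $\mathrm{ei}(\tau|\mu,0)=\max\{\mu-\tau,0\}$. EI2 strategy: for $t\ge1$, $A_{t+1}\in\mathrm{argmax}_{n\in[N]}\max\{\mathrm{ei}(\hat Y_t|M_t^n,\sqrt{C_t^{nn}}),\ \mathrm{ei}(-\check Y_t|-M_t^n,\sqrt{C_t^{nn}})\}$. UCB2 strategy: for $t\ge1$, $A_{t+1}\in\mathrm{argmax}_{n\in[N]}\max\{-\hat Y_t+M_t^n+\sqrt{C_t^{nn}2\log N},\ \check Y_t-M_t^n+\sqrt{C_t^{nn}2\log N}\}$. The first action $A_1$ is not prescribed by the strategies (any fixed choice); ties in the argmax are broken by a fixed rule depending only on the set of maximizers (e.g. smallest index), so the strategies are invariant under flipping the sign of $F$. $\log$ is the natural logarithm. *)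

theory Defs
  imports "HOL-Probability.Probability"
begin

text \<open>The normal distribution on the reals with mean \<open>m\<close> and standard deviation \<open>s \<ge> 0\<close>.
  The library's \<open>normal_density\<close> is identically zero for \<open>s = 0\<close>, where the
  distribution is the point mass at \<open>m\<close>.\<close>

definition normal_measure :: "real \<Rightarrow> real \<Rightarrow> real measure" where
  "normal_measure m s =
     (if s = 0 then return borel m else density lborel (\<lambda>x. ennreal (normal_density m s x)))"

text \<open>\<open>F \<sim> \<N>(\<mu>, \<Sigma>)\<close>, where \<open>\<Sigma>\<close> may be singular (so that there need not be a joint density):
  every linear form \<open>u \<bullet> F\<close> is normal with mean \<open>u \<bullet> \<mu>\<close> and variance \<open>u \<bullet> \<Sigma> u\<close>.\<close>

definition gaussian_vector ::
  "'a measure \<Rightarrow> ('a \<Rightarrow> real ^ 'n) \<Rightarrow> real ^ 'n \<Rightarrow> real ^ 'n ^ 'n \<Rightarrow> bool" where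
  "gaussian_vector M F \<mu> S \<longleftrightarrow>
     F \<in> borel_measurable M \<and>
     (\<forall>u. distr M borel (\<lambda>\<omega>. u \<bullet> F \<omega>) = normal_measure (u \<bullet> \<mu>) (sqrt (u \<bullet> (S *v u))))"

definition observation ::
  "('a \<Rightarrow> real ^ 'n) \<Rightarrow> (nat \<Rightarrow> 'a \<Rightarrow> 'n) \<Rightarrow> nat \<Rightarrow> 'a \<Rightarrow> real" where
  "observation F A t \<omega> = F \<omega> $ A t \<omega>"

definition max_obs :: "('a \<Rightarrow> real ^ 'n) \<Rightarrow> (nat \<Rightarrow> 'a \<Rightarrow> 'n) \<Rightarrow> nat \<Rightarrow> 'a \<Rightarrow> real" where
  "max_obs F A t \<omega> = Max ((\<lambda>k. observation F A k \<omega>) ` {1..t})"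

definition min_obs :: "('a \<Rightarrow> real ^ 'n) \<Rightarrow> (nat \<Rightarrow> 'a \<Rightarrow> 'n) \<Rightarrow> nat \<Rightarrow> 'a \<Rightarrow> real" where
  "min_obs F A t \<omega> = Min ((\<lambda>k. observation F A k \<omega>) ` {1..t})"

text \<open>The \<open>\<sigma>\<close>-algebra generated by the first \<open>t\<close> actions and observations.\<close>

definition history ::
  "'a measure \<Rightarrow> ('a \<Rightarrow> real ^ 'n) \<Rightarrow> (nat \<Rightarrow> 'a \<Rightarrow> 'n) \<Rightarrow> nat \<Rightarrow> 'a measure" where
  "history M F A t =
     vimage_algebra (space M) (\<lambda>\<omega>. \<lambda>k\<in>{1..t}. (A k \<omega>, observation F A k \<omega>))
       (PiM {1..t} (\<lambda>_. count_space UNIV \<Otimes>\<^sub>M borel))"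

definition post_mean ::
  "'a measure \<Rightarrow> ('a \<Rightarrow> real ^ 'n) \<Rightarrow> (nat \<Rightarrow> 'a \<Rightarrow> 'n) \<Rightarrow> nat \<Rightarrow> 'n \<Rightarrow> 'a \<Rightarrow> real" where
  "post_mean M F A t n = real_cond_exp M (history M F A t) (\<lambda>\<omega>. F \<omega> $ n)"

definition post_cov ::
  "'a measure \<Rightarrow> ('a \<Rightarrow> real ^ 'n) \<Rightarrow> (nat \<Rightarrow> 'a \<Rightarrow> 'n) \<Rightarrow> nat \<Rightarrow> 'n \<Rightarrow> 'n \<Rightarrow> 'a \<Rightarrow> real" where
  "post_cov M F A t m n =
     real_cond_exp M (history M F A t)
       (\<lambda>\<omega>. (F \<omega> $ m - post_mean M F A t m \<omega>) * (F \<omega> $ n - post_mean M F A t n \<omega>))"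

definition ei :: "real \<Rightarrow> real \<Rightarrow> real \<Rightarrow> real" where
  "ei \<tau> m s =
     (if s = 0 then max (m - \<tau>) 0 else (\<integral>x. max (x - \<tau>) 0 * normal_density m s x \<partial>lborel))"

definition ei2_acquisition ::
  "'a measure \<Rightarrow> ('a \<Rightarrow> real ^ 'n) \<Rightarrow> (nat \<Rightarrow> 'a \<Rightarrow> 'n) \<Rightarrow> nat \<Rightarrow> 'a \<Rightarrow> 'n \<Rightarrow> real" where
  "ei2_acquisition M F A t \<omega> n =
     max (ei (max_obs F A t \<omega>) (post_mean M F A t n \<omega>) (sqrt (post_cov M F A t n n \<omega>)))
         (ei (- min_obs F A t \<omega>) (- post_mean M F A t n \<omega>) (sqrt (post_cov M F A t n n \<omega>)))"

definition ucb2_acquisition ::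
  "'a measure \<Rightarrow> ('a \<Rightarrow> real ^ 'n) \<Rightarrow> (nat \<Rightarrow> 'a \<Rightarrow> 'n) \<Rightarrow> nat \<Rightarrow> 'a \<Rightarrow> 'n \<Rightarrow> real" where
  "ucb2_acquisition M F A t \<omega> n =
     max (- max_obs F A t \<omega> + post_mean M F A t n \<omega>
            + sqrt (post_cov M F A t n n \<omega> * 2 * ln (real CARD('n))))
         (min_obs F A t \<omega> - post_mean M F A t n \<omega>
            + sqrt (post_cov M F A t n n \<omega> * 2 * ln (real CARD('n))))"

definition tie_breaking_rule :: "('n set \<Rightarrow> 'n) \<Rightarrow> bool" where
  "tie_breaking_rule sel \<longleftrightarrow> (\<forall>S. S \<noteq> {} \<longrightarrow> sel S \<in> S)"

text \<open>An agent whose first action is fixed, whose later actions depend only on past actions and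
  observations, and which maximises the given acquisition function, breaking ties by \<open>sel\<close>.
  Posterior moments are conditional expectations and hence only determined up to null sets, so
  the choice of the action is prescribed almost surely.\<close>

definition follows_strategy ::
  "(nat \<Rightarrow> 'a \<Rightarrow> 'n \<Rightarrow> real) \<Rightarrow> ('n set \<Rightarrow> 'n) \<Rightarrow>
   'a measure \<Rightarrow> ('a \<Rightarrow> real ^ 'n) \<Rightarrow> nat \<Rightarrow> (nat \<Rightarrow> 'a \<Rightarrow> 'n) \<Rightarrow> bool" where
  "follows_strategy acq sel M F T A \<longleftrightarrow>
     (\<exists>a. \<forall>\<omega>\<in>space M. A 1 \<omega> = a) \<and>
     (\<forall>t\<in>{1..<T}.
        A (Suc t) \<in> measurable (history M F A t) (count_space UNIV) \<and>
        (AE \<omega> in M. A (Suc t) \<omega> = sel {n. is_arg_max (acq t \<omega>) (\<lambda>_. True) n}))"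

definition follows_ei2 ::
  "('n set \<Rightarrow> 'n) \<Rightarrow> 'a measure \<Rightarrow> ('a \<Rightarrow> real ^ 'n) \<Rightarrow> nat \<Rightarrow> (nat \<Rightarrow> 'a \<Rightarrow> 'n) \<Rightarrow> bool" where
  "follows_ei2 sel M F T A \<longleftrightarrow> follows_strategy (ei2_acquisition M F A) sel M F T A"

definition follows_ucb2 ::
  "('n set \<Rightarrow> 'n) \<Rightarrow> 'a measure \<Rightarrow> ('a \<Rightarrow> real ^ 'n) \<Rightarrow> nat \<Rightarrow> (nat \<Rightarrow> 'a \<Rightarrow> 'n) \<Rightarrow> bool" where
  "follows_ucb2 sel M F T A \<longleftrightarrow> follows_strategy (ucb2_acquisition M F A) sel M F T A"

end

theory Submission
  imports Defs "HOL-Real_Asymp.Real_Asymp"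
begin

text \<open>Let \<open>D\<close> be the range of the first \<open>t\<close> observations and \<open>G\<close> the posterior expectation of the
  range of \<open>F\<close>. With \<open>s = sqrt (2 ln N)\<close> and \<open>U\<close> the largest value over all arms, in either
  direction, of the posterior mean improvement plus \<open>s\<close> posterior standard deviations, one has
  \<open>G \<le> (1 + \<delta>) (D + 2 U)\<close>. The factor \<open>1 + \<delta>\<close> is needed because, for unequal variances, the
  expectation of a maximum of Gaussians can exceed the maximum of mean plus \<open>s\<close> deviations. If \<open>U\<close>
  is attained with deviation \<open>\<sigma>\<close> at distance \<open>w\<close> below the best value, then \<open>U = \<sigma> s - w\<close> and
  \<open>2 w \<le> D\<close>, while both strategies increase the expected range by at least
  \<open>(\<sigma> x - w) P(Z \<ge> x)\<close> for every \<open>x\<close>. At \<open>x = (1 + \<delta>) \<kappa> s\<close>, with \<open>\<kappa>\<close> the square root in the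
  claim, Mills' ratio gives \<open>P(Z \<ge> x) \<ge> 2 c\<close> for \<open>c = ln T / (2 sqrt \<pi> (T - 1))\<close>, so the
  expected increase is at least \<open>c (\<kappa> G - D)\<close>. Hence the gap between \<open>\<kappa>\<close> times the expected range
  of \<open>F\<close> and the expected range of the observations shrinks by the factor \<open>1 - c\<close> in each of the
  \<open>T - 1\<close> steps. As the law of \<open>F\<close> and the strategies are invariant under the sign change of
  \<open>F\<close>, expected ranges are twice expected maxima.

  The posterior is handled by resampling: replacing the part of \<open>F\<close> that is orthogonal to the
  observed arms by an independent copy preserves the law of \<open>F\<close> and the run of the policy.\<close>

section \<open>Determination of a measure by its trigonometric integrals\<close>

text \<open>Levy's uniqueness theorem concerns probability distributions. The characteristic
  function at 0 is the total mass, so both measures have the same mass and can be normalised by it;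
  mass zero is treated apart.\<close>

lemma finite_measure_eqI_char:
  fixes M N :: "real measure"
  assumes "finite_measure M" "finite_measure N"
    and sets: "sets M = sets borel" "sets N = sets borel"
    and eq: "char M = char N"
  shows "M = N"
proof -
  interpret M: finite_measure M by fact
  interpret N: finite_measure N by fact
  have sp: "space M = UNIV" "space N = UNIV"
    using sets_eq_imp_space_eq[OF sets(1)] sets_eq_imp_space_eq[OF sets(2)] by auto
  define m where "m = measure M UNIV"
  have "measure N UNIV = m"
    using fun_cong[OF eq, of 0] by (simp add: char_def sp m_def)
  then have mN: "emeasure N UNIV = ennreal m" and mM: "emeasure M UNIV = ennreal m"
    by (simp_all add: M.emeasure_eq_measure N.emeasure_eq_measure m_def)
  have "0 \<le> m" by (simp add: m_def)
  show ?thesis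
  proof (cases "m = 0")
    case True
    have "emeasure M A = emeasure N A" if "A \<in> sets M" for A
    proof -
      have "emeasure M A \<le> emeasure M UNIV" "emeasure N A \<le> emeasure N UNIV"
        using sets by (auto intro!: emeasure_mono)
      then show ?thesis using True mM mN by simp
    qed
    then show ?thesis using sets by (intro measure_eqI) auto
  next
    case False
    with \<open>0 \<le> m\<close> have m: "0 < m" by simp
    define M' N' where "M' = density M (\<lambda>_. ennreal (1/m))" and "N' = density N (\<lambda>_. ennreal (1/m))"
    have [measurable_cong]: "sets M' = sets borel" "sets N' = sets borel"
      by (simp_all add: M'_def N'_def sets)
    have rd: "real_distribution M'" "real_distribution N'"
      using m mM mN sp
      by (auto simp: real_distribution_def real_distribution_axioms_def M'_def N'_def sets
          emeasure_density nn_integral_cmult ennreal_mult[symmetric] intro!: prob_spaceI)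
    have "char M' = char N'"
    proof
      fix t
      have "char M' t = char M t / m"
        unfolding char_def M'_def using m
        by (subst integral_density) (auto simp: sets scaleR_conv_of_real divide_inverse mult.commute cong: measurable_cong_sets)
      moreover have "char N' t = char N t / m"
        unfolding char_def N'_def using m
        by (subst integral_density) (auto simp: sets scaleR_conv_of_real divide_inverse mult.commute cong: measurable_cong_sets)
      ultimately show "char M' t = char N' t" using eq by simp
    qed
    then have *: "M' = N'" by (rule Levy_uniqueness[OF rd])
    have "emeasure M A = emeasure N A" if A: "A \<in> sets M" for A
    proof -
      have "emeasure M' A = ennreal (1/m) * emeasure M A" "emeasure N' A = ennreal (1/m) * emeasure N A"
        using A sets by (auto simp: M'_def N'_def emeasure_density nn_integral_cmult)
      then have "ennreal (1/m) * emeasure M A = ennreal (1/m) * emeasure N A"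
        using * by simp
      then show ?thesis using m by (simp add: ennreal_mult_cancel_left)
    qed
    then show ?thesis using sets by (intro measure_eqI) auto
  qed
qed

text \<open>Freezing one coordinate at a time: the pushforward of the density
  \<open>1 + cos (u \<bullet> x + \<theta>)\<close> under a coordinate is a finite positive measure on the line, so that the
  one-dimensional uniqueness theorem applies to it.\<close>

lemma trig_integral_on_box_eq:
  fixes M N :: "'b::euclidean_space measure" and B :: "'b \<Rightarrow> real set"
  assumes "prob_space M" "prob_space N"
    and sets: "sets M = sets borel" "sets N = sets borel"
    and eq: "\<And>u \<theta>. (\<integral>x. cos (u \<bullet> x + \<theta>) \<partial>M) = (\<integral>x. cos (u \<bullet> x + \<theta>) \<partial>N)"
    and "I \<subseteq> Basis" and B: "\<And>i. i \<in> I \<Longrightarrow> B i \<in> sets borel"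
  shows "(\<integral>x. (\<Prod>i\<in>I. indicator (B i) (x \<bullet> i)) * cos (u \<bullet> x + \<theta>) \<partial>M)
       = (\<integral>x. (\<Prod>i\<in>I. indicator (B i) (x \<bullet> i)) * cos (u \<bullet> x + \<theta>) \<partial>N)"
proof -
  have "finite I" using \<open>I \<subseteq> Basis\<close> finite_Basis finite_subset by blast
  then show ?thesis using \<open>I \<subseteq> Basis\<close> B
  proof (induction I arbitrary: u \<theta> rule: finite_induct)
    case empty
    then show ?case using eq by simp
  next
    case (insert j I)
    define W :: "'b \<Rightarrow> real" where "W x = (\<Prod>i\<in>I. indicator (B i) (x \<bullet> i))" for x
    have IH: "(\<integral>x. W x * cos (u \<bullet> x + \<theta>) \<partial>M) = (\<integral>x. W x * cos (u \<bullet> x + \<theta>) \<partial>N)" for u \<theta>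
      unfolding W_def using insert.prems by (intro insert.IH) auto
    have Bm: "B i \<in> sets borel" if "i \<in> I" for i using insert.prems that by auto
    have Wm[measurable]: "W \<in> borel_measurable borel"
      unfolding W_def using Bm by (intro borel_measurable_prod) (auto intro!: measurable_If)
    have W01: "0 \<le> W x" "W x \<le> 1" for x
      unfolding W_def by (auto intro!: prod_nonneg prod_le_1 simp: indicator_def)
    have [measurable]: "B j \<in> sets borel" using insert.prems by auto
    define \<mu> where "\<mu> K u \<theta> = distr (density K (\<lambda>x. ennreal (W x * (1 + cos (u \<bullet> x + \<theta>))))) borel (\<lambda>x. x \<bullet> j)"
      for K u \<theta>
    have dens0: "0 \<le> W x * (1 + cos (u \<bullet> x + \<theta>))" for x u \<theta>
      using W01(1)[of x] cos_ge_minus_one[of "u \<bullet> x + \<theta>"] by (intro mult_nonneg_nonneg) linarith+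
    have dens2: "W x * (1 + cos (u \<bullet> x + \<theta>)) \<le> 2" for x u \<theta>
      using mult_mono[of "W x" 1 "1 + cos (u \<bullet> x + \<theta>)" 2] W01[of x] cos_ge_minus_one[of "u \<bullet> x + \<theta>"]
        cos_le_one[of "u \<bullet> x + \<theta>"] by linarith
    have fin: "finite_measure (\<mu> K u \<theta>)" if "prob_space K" and sK[measurable_cong]: "sets K = sets borel" for K u \<theta>
    proof -
      interpret K: prob_space K by fact
      have "(\<integral>\<^sup>+x. ennreal (W x * (1 + cos (u \<bullet> x + \<theta>))) \<partial>K) \<le> (\<integral>\<^sup>+x. ennreal 2 \<partial>K)"
        by (intro nn_integral_mono ennreal_leI dens2)
      also have "\<dots> < \<infinity>" by (simp add: K.emeasure_space_1)
      finally show ?thesis unfolding \<mu>_def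
        by (intro finite_measureI) (auto simp: emeasure_distr emeasure_density space_distr
            cong: nn_integral_cong)
    qed
    have int_\<mu>: "(\<integral>y. g y \<partial>\<mu> K u \<theta>) = (\<integral>x. (W x * (1 + cos (u \<bullet> x + \<theta>))) *\<^sub>R g (x \<bullet> j) \<partial>K)"
      if sK[measurable_cong]: "sets K = sets borel" and [measurable]: "g \<in> borel_measurable borel"
      for K u \<theta> and g :: "real \<Rightarrow> 'c::{banach,second_countable_topology}"
      unfolding \<mu>_def using dens0
      by (subst integral_distr, simp, simp, subst integral_density, simp_all)
    have bint: "integrable K (\<lambda>x. W x * cos (g x))"
      if "prob_space K" and sK[measurable_cong]: "sets K = sets borel" and [measurable]: "g \<in> borel_measurable borel" for K g
    proof -
      interpret K: prob_space K by fact
      show ?thesis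
        using W01 by (intro K.integrable_const_bound[where B = 1])
          (auto simp: abs_mult intro!: mult_le_one)
    qed
    \<comment> \<open>The product-to-sum formula absorbs the frequency \<open>s\<close> of the
      coordinate \<open>j\<close> into the vectors \<open>u + s *\<^sub>R j\<close> and
      \<open>u - s *\<^sub>R j\<close>. Only integrals covered by \<open>IH\<close> remain, as that
      holds for all vectors and phases.\<close>
    have charcos: "(\<integral>y. cos (s * y + \<phi>) \<partial>\<mu> K u \<theta>) =
        (\<integral>x. W x * cos ((s *\<^sub>R j) \<bullet> x + \<phi>) \<partial>K) +
        ((\<integral>x. W x * cos ((u + s *\<^sub>R j) \<bullet> x + (\<theta> + \<phi>)) \<partial>K) +
         (\<integral>x. W x * cos ((u - s *\<^sub>R j) \<bullet> x + (\<theta> - \<phi>)) \<partial>K)) / 2"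
      if pK: "prob_space K" and sK[measurable_cong]: "sets K = sets borel" for K u \<theta> s \<phi>
    proof -
      have "(W x * (1 + cos (u \<bullet> x + \<theta>))) *\<^sub>R cos (s * (x \<bullet> j) + \<phi>) =
          W x * cos ((s *\<^sub>R j) \<bullet> x + \<phi>) +
          (W x * cos ((u + s *\<^sub>R j) \<bullet> x + (\<theta> + \<phi>)) + W x * cos ((u - s *\<^sub>R j) \<bullet> x + (\<theta> - \<phi>))) / 2" for x
      proof -
        have 1: "(u + s *\<^sub>R j) \<bullet> x + (\<theta> + \<phi>) = (u \<bullet> x + \<theta>) + (s * (x \<bullet> j) + \<phi>)"
          "(u - s *\<^sub>R j) \<bullet> x + (\<theta> - \<phi>) = (u \<bullet> x + \<theta>) - (s * (x \<bullet> j) + \<phi>)"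
          "(s *\<^sub>R j) \<bullet> x = s * (x \<bullet> j)"
          by (simp_all add: algebra_simps inner_commute)
        show ?thesis unfolding 1 cos_add[of "u \<bullet> x + \<theta>"] cos_diff[of "u \<bullet> x + \<theta>"]
          by (simp add: algebra_simps)
      qed
      then show ?thesis
        using bint[OF pK sK]
        by (subst int_\<mu>[OF sK]) (simp_all add: pK sK)
    qed
    have \<mu>_eq: "\<mu> M u \<theta> = \<mu> N u \<theta>" for u \<theta>
    proof (rule finite_measure_eqI_char)
      show "finite_measure (\<mu> M u \<theta>)" "finite_measure (\<mu> N u \<theta>)"
        using assms fin by auto
      show "sets (\<mu> M u \<theta>) = sets borel" "sets (\<mu> N u \<theta>) = sets borel" by (simp_all add: \<mu>_def)
      show "char (\<mu> M u \<theta>) = char (\<mu> N u \<theta>)"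
      proof
        fix s
        \<comment> \<open>The sine is the cosine with phase \<open>- pi/2\<close>, so cosines with
          arbitrary phases yield both parts of the characteristic function.\<close>
        have c: "char (\<mu> K u \<theta>) s = complex_of_real (\<integral>y. cos (s * y + 0) \<partial>\<mu> K u \<theta>)
             + \<i> * complex_of_real (\<integral>y. cos (s * y + (- pi/2)) \<partial>\<mu> K u \<theta>)"
          if pK: "prob_space K" and sK: "sets K = sets borel" for K
        proof -
          interpret finite_measure "\<mu> K u \<theta>" by (rule fin[OF pK sK])
          have [measurable_cong]: "sets (\<mu> K u \<theta>) = sets borel" by (simp add: \<mu>_def)
          have "integrable (\<mu> K u \<theta>) (\<lambda>y. complex_of_real (cos (s * y)))"
            "integrable (\<mu> K u \<theta>) (\<lambda>y. complex_of_real (sin (s * y)))"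
            by (auto intro!: integrable_const_bound[where B = 1])
          moreover have "cos (s * y + (- pi/2)) = sin (s * y)" for y
            by (simp add: cos_diff)
          moreover have "iexp (s * y) = complex_of_real (cos (s * y)) + \<i> * complex_of_real (sin (s * y))" for y
            by (simp add: cis_conv_exp[symmetric] complex_eq_iff del: of_real_mult)
          ultimately show ?thesis unfolding char_def
            by (simp del: of_real_mult)
        qed
        show "char (\<mu> M u \<theta>) s = char (\<mu> N u \<theta>) s"
          unfolding c[OF assms(1) sets(1)] c[OF assms(2) sets(2)]
            charcos[OF assms(1) sets(1)] charcos[OF assms(2) sets(2)] IH ..
      qed
    qed
    have W_eq: "(\<integral>x. indicator (B j) (x \<bullet> j) * (W x * (1 + cos (u \<bullet> x + \<theta>))) \<partial>M)
       = (\<integral>x. indicator (B j) (x \<bullet> j) * (W x * (1 + cos (u \<bullet> x + \<theta>))) \<partial>N)" for u \<theta>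
    proof -
      have "(\<integral>x. indicator (B j) (x \<bullet> j) * (W x * (1 + cos (u \<bullet> x + \<theta>))) \<partial>K) = (\<integral>y. indicator (B j) y \<partial>\<mu> K u \<theta>)"
        if "sets K = sets borel" for K
        by (subst int_\<mu>[OF that]) (simp_all add: mult.commute)
      then show ?thesis using sets by (simp only: \<mu>_eq)
    qed
    \<comment> \<open>The vector 0 and the phase 0 give the density \<open>2 * W x\<close>; half of
      it removes the constant 1 that was added for positivity.\<close>
    have "(\<integral>x. indicator (B j) (x \<bullet> j) * (W x * cos (u \<bullet> x + \<theta>)) \<partial>K)
       = (\<integral>x. indicator (B j) (x \<bullet> j) * (W x * (1 + cos (u \<bullet> x + \<theta>))) \<partial>K)
         - (\<integral>x. indicator (B j) (x \<bullet> j) * (W x * (1 + cos (0 \<bullet> x + 0))) \<partial>K) / 2"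
      if pK: "prob_space K" and sK[measurable_cong]: "sets K = sets borel" for K
    proof -
      interpret K: prob_space K by fact
      have i: "integrable K (\<lambda>x. indicator (B j) (x \<bullet> j) * W x)"
        "integrable K (\<lambda>x. indicator (B j) (x \<bullet> j) * (W x * cos (u \<bullet> x + \<theta>)))"
        using W01 by (auto intro!: K.integrable_const_bound[where B = 1] simp: abs_mult indicator_def mult_le_one)
      show ?thesis using i
        by (simp add: distrib_left mult.assoc[symmetric])
    qed
    then have "(\<integral>x. indicator (B j) (x \<bullet> j) * (W x * cos (u \<bullet> x + \<theta>)) \<partial>M)
       = (\<integral>x. indicator (B j) (x \<bullet> j) * (W x * cos (u \<bullet> x + \<theta>)) \<partial>N)"
      using W_eq assms(1,2) sets by (simp only:)
    then show ?case
      using insert.hyps by (simp add: W_def mult.assoc)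
  qed
qed

text \<open>At \<open>u = 0\<close> and \<open>\<theta> = 0\<close> the previous lemma shows that
  all open boxes have equal measure, and these form an intersection-stable generator. Invariance of
  a Gaussian law is thereby reduced to a computation with quadratic forms.\<close>

theorem measure_eqI_trig:
  fixes M N :: "'b::euclidean_space measure"
  assumes "prob_space M" "prob_space N"
    and sets: "sets M = sets borel" "sets N = sets borel"
    and eq: "\<And>u \<theta>. (\<integral>x. cos (u \<bullet> x + \<theta>) \<partial>M) = (\<integral>x. cos (u \<bullet> x + \<theta>) \<partial>N)"
  shows "M = N"
proof -
  interpret M: prob_space M by fact
  interpret N: prob_space N by fact
  let ?E = "range (\<lambda>(a, b). box a b :: 'b set)"
  have box: "(\<Prod>i\<in>Basis. indicator {a \<bullet> i <..< b \<bullet> i} (x \<bullet> i) :: real) = indicator (box a b) x"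
    for a b x :: 'b
    by (auto simp: indicator_def mem_box prod.If_cases split: if_splits)
  have "measure M (box a b) = measure N (box a b)" for a b :: 'b
    using trig_integral_on_box_eq[OF assms, of Basis "\<lambda>i. {a \<bullet> i <..< b \<bullet> i}" 0 0] sets
    by (simp add: box)
  then have me: "emeasure M X = emeasure N X" if "X \<in> ?E" for X
    using that by (auto simp: M.emeasure_eq_measure N.emeasure_eq_measure)
  show ?thesis
  proof (rule measure_eqI_generator_eq)
    show "Int_stable ?E"
      by (auto simp: Int_stable_def box_Int_box)
    show "?E \<subseteq> Pow UNIV" by simp
    show "sets M = sigma_sets UNIV ?E" "sets N = sigma_sets UNIV ?E"
      unfolding sets by (subst borel_eq_box, simp)+
    let ?A = "\<lambda>n::nat. box (- (real n *\<^sub>R One)) (real n *\<^sub>R One) :: 'b set"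
    show "range ?A \<subseteq> ?E" by auto
    show "(\<Union>i. ?A i) = UNIV" by (rule UN_box_eq_UNIV)
    show "emeasure M (?A i) \<noteq> \<infinity>" for i by simp
  qed (rule me)
qed

section \<open>Centred Gaussian measures and resampling of the unobserved part\<close>

text \<open>Includes the point mass as the case \<open>s = 0\<close>, so that singular covariances
  need no separate treatment later.\<close>

lemma normal_measure_eq_distr:
  assumes "0 \<le> s"
  shows "normal_measure m s = distr std_normal_distribution borel (\<lambda>x. m + s * x)"
proof -
  interpret prob_space std_normal_distribution
    by (rule prob_space_normal_density) simp
  show ?thesis
  proof (cases "s = 0")
    case True
    then show ?thesis by (simp add: normal_measure_def distr_const)
  next
    case False
    with assms have s: "0 < s" by simp
    have "distributed std_normal_distribution lborel (\<lambda>x. x) std_normal_density"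
      by (auto simp: distributed_def distr_id2)
    from normal_density_affine[OF this, of s m] s
    have "distributed std_normal_distribution lborel (\<lambda>x. m + s * x) (normal_density m s)"
      by simp
    from distributed_distr_eq_density[OF this]
    have "distr std_normal_distribution lborel (\<lambda>x. m + s * x) = density lborel (\<lambda>x. ennreal (normal_density m s x))" .
    moreover have "distr std_normal_distribution lborel (\<lambda>x. m + s * x) = distr std_normal_distribution borel (\<lambda>x. m + s * x)"
      by (rule distr_cong) auto
    ultimately show ?thesis using s by (simp add: normal_measure_def)
  qed
qed

text \<open>The real part of \<open>cis \<theta>\<close> times the standard normal characteristic
  function.\<close>

lemma integral_cos_std_normal:
  "(\<integral>x. cos (s * x + \<theta>) \<partial>std_normal_distribution) = exp (- (s\<^sup>2) / 2) * cos \<theta>"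
proof -
  interpret prob_space std_normal_distribution
    by (rule prob_space_normal_density) simp
  have int: "integrable std_normal_distribution (\<lambda>x. iexp (s * x))"
    by (intro integrable_const_bound[where B = 1]) auto
  have "complex_of_real (exp (- (s\<^sup>2) / 2)) = (CLINT x|std_normal_distribution. iexp (s * x))"
    using fun_cong[OF char_std_normal_distribution, of s] by (simp add: char_def)
  then have "exp (- (s\<^sup>2) / 2) * cos \<theta> = Re (cis \<theta> * (CLINT x|std_normal_distribution. iexp (s * x)))"
    by (metis Re_complex_of_real Re_complex_div_eq_0 cis.sel(1) mult.commute times_complex.sel(1) Im_complex_of_real mult_zero_left diff_zero)
  also have "\<dots> = Re (CLINT x|std_normal_distribution. cis \<theta> * iexp (s * x))"
    using int by simp
  also have "\<dots> = (\<integral>x. Re (cis \<theta> * iexp (s * x)) \<partial>std_normal_distribution)"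
    using int by (intro integral_Re[symmetric]) simp
  also have "\<dots> = (\<integral>x. cos (s * x + \<theta>) \<partial>std_normal_distribution)"
    by (simp add: cis_conv_exp[symmetric] cis_mult add.commute del: of_real_mult)
  finally show ?thesis by simp
qed

section \<open>Orthogonal projection with respect to a semidefinite form\<close>

lemma matrix_vector_mult_uminus: "A *v (- x) = - (A *v (x :: real ^ 'n))"
  using matrix_vector_mult_scaleR[of A "-1" x] by simp

text \<open>Gram-Schmidt for the semi-inner product given by \<open>S\<close>: the new vector
  \<open>v\<close> is replaced by its part \<open>r\<close> orthogonal to the span of
  \<open>V\<close>, and the projection of \<open>x\<close> gains a multiple of
  \<open>r\<close>.\<close>

lemma exists_semidefinite_projection:
  fixes S :: "real ^ 'n ^ 'n"
  assumes sym: "transpose S = S" and psd: "\<And>x. 0 \<le> x \<bullet> (S *v x)" and "finite V"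
  shows "\<exists>b\<in>span V. \<forall>v\<in>V. (x - b) \<bullet> (S *v v) = 0"
  using \<open>finite V\<close>
proof (induction V arbitrary: x rule: finite_induct)
  case empty
  then show ?case by auto
next
  case (insert v V)
  have comm: "a \<bullet> (S *v c) = c \<bullet> (S *v a)" for a c
    by (metis dot_lmul_matrix inner_commute sym transpose_matrix_vector)
  obtain bv where bv: "bv \<in> span V" "\<And>w. w \<in> V \<Longrightarrow> (v - bv) \<bullet> (S *v w) = 0"
    using insert.IH[of v] by blast
  obtain bx where bx: "bx \<in> span V" "\<And>w. w \<in> V \<Longrightarrow> (x - bx) \<bullet> (S *v w) = 0"
    using insert.IH[of x] by blast
  define r where "r = v - bv"
  define q where "q = r \<bullet> (S *v r)"
  define p where "p = (x - bx) \<bullet> (S *v r)"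
  have span0: "y \<bullet> (S *v w) = 0" if "w \<in> span V" "\<And>w. w \<in> V \<Longrightarrow> y \<bullet> (S *v w) = 0" for y w
  proof -
    have "subspace {w. y \<bullet> (S *v w) = 0}"
      by (auto simp: subspace_def matrix_vector_right_distrib inner_add_right matrix_vector_mult_scaleR)
    then have "span V \<subseteq> {w. y \<bullet> (S *v w) = 0}"
      using that(2) by (intro span_minimal) auto
    then show ?thesis using that(1) by auto
  qed
  \<comment> \<open>The degenerate case of the Cauchy-Schwarz inequality. If \<open>q = 0\<close>,
    the form at \<open>e + c *\<^sub>R r\<close> is affine in \<open>c\<close>; the \<open>c\<close>
    chosen below would make it -1.\<close>
  have "q = 0 \<Longrightarrow> p = 0"
  proof (rule ccontr)
    assume q: "q = 0" and p: "p \<noteq> 0"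
    define e where "e = x - bx"
    have pe: "p = e \<bullet> (S *v r)" by (simp add: p_def e_def)
    define c where "c = - (e \<bullet> (S *v e) + 1) / (2 * p)"
    have "(e + c *\<^sub>R r) \<bullet> (S *v (e + c *\<^sub>R r)) = e \<bullet> (S *v e) + 2 * c * p + c\<^sup>2 * q"
      using comm[of r e]
      by (simp add: pe q_def matrix_vector_right_distrib inner_add_right inner_add_left
          matrix_vector_mult_scaleR power2_eq_square algebra_simps)
    also have "\<dots> = -1" using p q by (simp add: c_def field_simps)
    finally show False using psd[of "e + c *\<^sub>R r"] by simp
  qed
  \<comment> \<open>For \<open>q = 0\<close> the quotient is 0 by convention, which is the right
    coefficient as then \<open>p = 0\<close>.\<close>
  then have pq: "p - (p / q) * q = 0" by auto
  let ?b = "bx + (p / q) *\<^sub>R r"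
  have bspan: "?b \<in> span (insert v V)"
    unfolding r_def using bx(1) bv(1)
    by (intro span_add span_scale span_diff span_base[of v])
      (auto intro: span_mono[THEN subsetD, of V])
  have onV: "(x - ?b) \<bullet> (S *v w) = 0" if "w \<in> V" for w
  proof -
    have "(x - ?b) \<bullet> (S *v w) = (x - bx) \<bullet> (S *v w) - (p / q) * (r \<bullet> (S *v w))"
      by (simp add: inner_diff_left inner_add_left)
    then show ?thesis using bx(2)[OF that] bv(2)[OF that] by (simp add: r_def)
  qed
  have "(x - ?b) \<bullet> (S *v v) = (x - ?b) \<bullet> (S *v r) + (x - ?b) \<bullet> (S *v bv)"
    by (simp add: r_def inner_diff_right matrix_vector_mult_diff_distrib)
  also have "(x - ?b) \<bullet> (S *v bv) = 0"
    by (rule span0[OF bv(1) onV])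
  also have "(x - ?b) \<bullet> (S *v r) = p - (p / q) * q"
    by (simp add: p_def q_def inner_diff_left inner_add_left)
  finally have "(x - ?b) \<bullet> (S *v v) = 0" using pq by simp
  then show ?case using bspan onV by (intro bexI[of _ ?b]) auto
qed

text \<open>The prior as a law on the space of arm values. There an independent copy is available
  through the product \<open>\<nu> \<Otimes>\<^sub>M \<nu>\<close>, whatever the underlying
  probability space.\<close>

locale centered_gaussian = prob_space \<nu>
  for \<nu> :: "(real ^ 'n) measure" and S :: "real ^ 'n ^ 'n" +
  assumes sets_eq[measurable_cong]: "sets \<nu> = sets borel"
    and symmetric: "transpose S = S"
    and psd: "0 \<le> x \<bullet> (S *v x)"
    and distr_inner: "distr \<nu> borel (\<lambda>f. u \<bullet> f) = normal_measure 0 (sqrt (u \<bullet> (S *v u)))"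
begin

lemma space_eq[simp]: "space \<nu> = UNIV"
  using sets_eq_imp_space_eq[OF sets_eq] by simp

lemma form_commute: "a \<bullet> (S *v c) = c \<bullet> (S *v a)"
  by (metis dot_lmul_matrix inner_commute symmetric transpose_matrix_vector)

definition sd :: "real ^ 'n \<Rightarrow> real" where "sd u = sqrt (u \<bullet> (S *v u))"

lemma sd_nonneg[simp]: "0 \<le> sd u" using psd[of u] by (simp add: sd_def)

lemma sd_sq: "(sd u)\<^sup>2 = u \<bullet> (S *v u)" using psd[of u] by (simp add: sd_def)

lemma distr_inner_std: "distr \<nu> borel (\<lambda>f. u \<bullet> f) = distr std_normal_distribution borel (\<lambda>x. sd u * x)"
  using normal_measure_eq_distr[of "sd u" 0] distr_inner[of u] by (simp add: sd_def psd)

lemma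
  fixes h :: "real \<Rightarrow> real"
  assumes [measurable]: "h \<in> borel_measurable borel"
  shows integral_inner: "(\<integral>f. h (u \<bullet> f) \<partial>\<nu>) = (\<integral>x. h (sd u * x) \<partial>std_normal_distribution)"
    and integrable_inner_iff: "integrable \<nu> (\<lambda>f. h (u \<bullet> f)) \<longleftrightarrow> integrable std_normal_distribution (\<lambda>x. h (sd u * x))"
proof -
  have "(\<integral>f. h (u \<bullet> f) \<partial>\<nu>) = (\<integral>y. h y \<partial>distr \<nu> borel (\<lambda>f. u \<bullet> f))"
    by (subst integral_distr) auto
  also have "\<dots> = (\<integral>x. h (sd u * x) \<partial>std_normal_distribution)"
    unfolding distr_inner_std by (subst integral_distr) auto
  finally show "(\<integral>f. h (u \<bullet> f) \<partial>\<nu>) = (\<integral>x. h (sd u * x) \<partial>std_normal_distribution)" .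
  have "integrable \<nu> (\<lambda>f. h (u \<bullet> f)) \<longleftrightarrow> integrable (distr \<nu> borel (\<lambda>f. u \<bullet> f)) h"
    by (subst integrable_distr_eq) auto
  also have "\<dots> \<longleftrightarrow> integrable std_normal_distribution (\<lambda>x. h (sd u * x))"
    unfolding distr_inner_std by (subst integrable_distr_eq) auto
  finally show "integrable \<nu> (\<lambda>f. h (u \<bullet> f)) \<longleftrightarrow> integrable std_normal_distribution (\<lambda>x. h (sd u * x))" .
qed

lemma integrable_inner[simp]: "integrable \<nu> (\<lambda>f. u \<bullet> f)"
  using integrable_inner_iff[of "\<lambda>x. x" u] integrable_std_normal_distribution_moment[of 1] by simp

lemma integrable_inner_sq[simp]: "integrable \<nu> (\<lambda>f. (u \<bullet> f)\<^sup>2)"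
  using integrable_inner_iff[of "\<lambda>x. x\<^sup>2" u] integrable_std_normal_distribution_moment[of 2]
  by (simp add: power_mult_distrib)

lemma integral_inner_eq_0[simp]: "(\<integral>f. u \<bullet> f \<partial>\<nu>) = 0"
  using integral_inner[of "\<lambda>x. x" u] integral_std_normal_distribution_moment_odd[of 1] by simp

lemma integral_inner_sq: "(\<integral>f. (u \<bullet> f)\<^sup>2 \<partial>\<nu>) = (sd u)\<^sup>2"
  using integral_inner[of "\<lambda>x. x\<^sup>2" u] std_normal_distribution_even_moments(1)[of 1]
  by (simp add: power_mult_distrib)

lemma integral_cos_inner: "(\<integral>f. cos (u \<bullet> f + \<theta>) \<partial>\<nu>) = exp (- (u \<bullet> (S *v u)) / 2) * cos \<theta>"
  using integral_inner[of "\<lambda>x. cos (x + \<theta>)" u] integral_cos_std_normal[of "sd u" \<theta>]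
  by (simp add: sd_sq)

text \<open>The cosine integrals depend on \<open>u\<close> only through an even quadratic
  form.\<close>

lemma distr_uminus: "distr \<nu> borel uminus = \<nu>"
proof (rule measure_eqI_trig)
  show "prob_space (distr \<nu> borel uminus)" by (rule prob_space_distr) simp
  show "(\<integral>x. cos (u \<bullet> x + \<theta>) \<partial>distr \<nu> borel uminus) = (\<integral>x. cos (u \<bullet> x + \<theta>) \<partial>\<nu>)" for u \<theta>
    using integral_cos_inner[of "- u" \<theta>] integral_cos_inner[of u \<theta>]
    by (simp add: integral_distr matrix_vector_mult_uminus)
qed (simp_all add: sets_eq, unfold_locales)

text \<open>The regression of an arm on the arms in \<open>I\<close>; it need not be unique, as \<open>S\<close> may be
  singular. The case distinction makes resampling preserve the arms in \<open>I\<close> everywhere and not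
  just almost surely.\<close>

definition regr :: "'n set \<Rightarrow> 'n \<Rightarrow> real ^ 'n" where
  "regr I n = (if n \<in> I then axis n 1
     else SOME b. b \<in> span ((\<lambda>i. axis i 1) ` I) \<and> (\<forall>i\<in>I. (axis n 1 - b) \<bullet> (S *v axis i 1) = 0))"

definition resid :: "'n set \<Rightarrow> 'n \<Rightarrow> real ^ 'n" where
  "resid I n = axis n 1 - regr I n"

definition resample :: "'n set \<Rightarrow> real ^ 'n \<Rightarrow> real ^ 'n \<Rightarrow> real ^ 'n" where
  "resample I f g = (\<chi> n. regr I n \<bullet> f + resid I n \<bullet> g)"

lemma
  shows regr_in_span: "regr I n \<in> span ((\<lambda>i. axis i 1) ` I)"
    and resid_orthogonal_axis: "i \<in> I \<Longrightarrow> resid I n \<bullet> (S *v axis i 1) = 0"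
proof -
  have *: "regr I n \<in> span ((\<lambda>i. axis i 1) ` I) \<and> (\<forall>i\<in>I. (axis n 1 - regr I n) \<bullet> (S *v axis i 1) = 0)"
  proof (cases "n \<in> I")
    case True
    then show ?thesis by (auto simp: regr_def intro: span_base)
  next
    case False
    show ?thesis
      unfolding regr_def if_not_P[OF False]
      using exists_semidefinite_projection[OF symmetric psd, of "(\<lambda>i. axis i 1) ` I" "axis n 1"]
      by (intro someI_ex[of "\<lambda>b. b \<in> span ((\<lambda>i. axis i 1) ` I) \<and> (\<forall>i\<in>I. (axis n 1 - b) \<bullet> (S *v axis i 1) = 0)"]) auto
  qed
  then show "regr I n \<in> span ((\<lambda>i. axis i 1) ` I)"
    and "i \<in> I \<Longrightarrow> resid I n \<bullet> (S *v axis i 1) = 0"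
    by (auto simp: resid_def)
qed

lemma resid_orthogonal:
  assumes "v \<in> span ((\<lambda>i. axis i 1) ` I)"
  shows "resid I n \<bullet> (S *v v) = 0"
proof -
  have "subspace {w. resid I n \<bullet> (S *v w) = 0}"
    by (auto simp: subspace_def matrix_vector_right_distrib inner_add_right matrix_vector_mult_scaleR)
  then have "span ((\<lambda>i. axis i 1) ` I) \<subseteq> {w. resid I n \<bullet> (S *v w) = 0}"
    using resid_orthogonal_axis by (intro span_minimal) auto
  then show ?thesis using assms by auto
qed

text \<open>A regression vector lies in the span of the unit vectors of the arms in
  \<open>I\<close>, so its linear form can be evaluated from observed values alone.\<close>

lemma regr_inner_cong:
  assumes "\<And>i. i \<in> I \<Longrightarrow> f $ i = g $ i"
  shows "regr I n \<bullet> f = regr I n \<bullet> g"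
proof -
  have "subspace {w. w \<bullet> (f - g) = 0}"
    by (auto simp: subspace_def inner_add_left)
  then have "span ((\<lambda>i. axis i 1) ` I) \<subseteq> {w. w \<bullet> (f - g) = 0}"
    using assms by (intro span_minimal) (auto simp: inner_axis' vector_minus_component)
  then show ?thesis using regr_in_span[of I n] by (auto simp: inner_diff_right)
qed

lemma resample_observed: "n \<in> I \<Longrightarrow> resample I f g $ n = f $ n"
  by (simp add: resample_def regr_def resid_def inner_axis')

lemma regr_resample[simp]: "regr I n \<bullet> resample I f g = regr I n \<bullet> f"
  by (rule regr_inner_cong) (simp add: resample_observed)

lemma measurable_resample[measurable]:
  "(\<lambda>x. resample I (fst x) (snd x)) \<in> borel_measurable (borel \<Otimes>\<^sub>M borel)"
proof -
  have "resample I f g = (\<Sum>n\<in>UNIV. (regr I n \<bullet> f + resid I n \<bullet> g) *\<^sub>R axis n 1)" for f g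
    by (simp add: resample_def vec_eq_iff axis_def if_distrib cong: if_cong)
  then show ?thesis by simp
qed

text \<open>Residuals are uncorrelated with the observed arms. Split \<open>u\<close> into its
  regression part \<open>p\<close> and its residual part \<open>q\<close>: the cross terms of the
  quadratic form vanish, so independent arguments in the two parts give the same variance as a
  common one.\<close>

theorem distr_resample:
  "distr (\<nu> \<Otimes>\<^sub>M \<nu>) borel (\<lambda>x. resample I (fst x) (snd x)) = \<nu>"
proof -
  interpret P: pair_prob_space \<nu> \<nu> ..
  show ?thesis
  proof (rule measure_eqI_trig)
    fix u \<theta>
    define p where "p = (\<Sum>n\<in>UNIV. (u $ n) *\<^sub>R regr I n)"
    define q where "q = (\<Sum>n\<in>UNIV. (u $ n) *\<^sub>R resid I n)"
    have inner_resample: "u \<bullet> resample I f g = p \<bullet> f + q \<bullet> g" for f g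
      by (simp add: p_def q_def resample_def inner_vec_def[of u] inner_sum_left sum.distrib distrib_left)
    have "p + q = (\<Sum>n\<in>UNIV. (u $ n) *\<^sub>R axis n 1)"
      by (simp add: p_def q_def resid_def sum.distrib[symmetric] algebra_simps)
    also have "\<dots> = u"
      by (simp add: vec_eq_iff axis_def if_distrib cong: if_cong)
    finally have pq: "p + q = u" .
    have "p \<in> span ((\<lambda>i. axis i 1) ` I)"
      unfolding p_def by (intro span_sum span_scale regr_in_span)
    then have qp: "q \<bullet> (S *v p) = 0"
      by (simp add: q_def inner_sum_left resid_orthogonal)
    have var: "u \<bullet> (S *v u) = p \<bullet> (S *v p) + q \<bullet> (S *v q)"
      using qp form_commute[of p q]
      by (simp flip: pq add: matrix_vector_right_distrib inner_add_left inner_add_right)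
    have "(\<integral>x. cos (u \<bullet> x + \<theta>) \<partial>distr (\<nu> \<Otimes>\<^sub>M \<nu>) borel (\<lambda>x. resample I (fst x) (snd x)))
      = (\<integral>x. cos (q \<bullet> snd x + (p \<bullet> fst x + \<theta>)) \<partial>(\<nu> \<Otimes>\<^sub>M \<nu>))"
      by (subst integral_distr) (simp_all add: inner_resample algebra_simps)
    also have "\<dots> = (\<integral>f. (\<integral>g. cos (q \<bullet> g + (p \<bullet> f + \<theta>)) \<partial>\<nu>) \<partial>\<nu>)"
      by (subst P.integral_fst'[symmetric]) (auto intro!: P.P.integrable_const_bound[where B = 1])
    also have "\<dots> = exp (- (u \<bullet> (S *v u)) / 2) * cos \<theta>"
      by (simp add: integral_cos_inner var exp_add[symmetric] add_divide_distrib diff_divide_distrib)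
    also have "\<dots> = (\<integral>x. cos (u \<bullet> x + \<theta>) \<partial>\<nu>)" by (simp add: integral_cos_inner)
    finally show "(\<integral>x. cos (u \<bullet> x + \<theta>) \<partial>distr (\<nu> \<Otimes>\<^sub>M \<nu>) borel (\<lambda>x. resample I (fst x) (snd x)))
      = (\<integral>x. cos (u \<bullet> x + \<theta>) \<partial>\<nu>)" .
  next
    show "prob_space (distr (\<nu> \<Otimes>\<^sub>M \<nu>) borel (\<lambda>x. resample I (fst x) (snd x)))"
      by (rule P.P.prob_space_distr) simp
  qed (simp_all add: sets_eq, unfold_locales)
qed

end

section \<open>Tails of the normal distribution and expected improvement\<close>

abbreviation "std_tail x \<equiv> measure std_normal_distribution {x..}"

lemma std_tail_bounds: "0 \<le> std_tail x" "std_tail x \<le> 1"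
  using prob_space.prob_le_1[OF prob_space_normal_density[of 1 0]] by auto

lemma std_normal_density_has_derivative[derivative_intros]:
  "(f has_real_derivative f') (at x) \<Longrightarrow>
    ((\<lambda>x. std_normal_density (f x)) has_real_derivative - f x * std_normal_density (f x) * f') (at x)"
  unfolding std_normal_density_def
  by (auto intro!: derivative_eq_intros simp: field_simps power2_eq_square)

text \<open>As \<open>1 - 2 / (1 + x\<^sup>2)\<^sup>2\<close> is at most 1, this function decreases
  no faster than the normal tail. It serves both for the lower bound on the tail and for the upper
  bound on expected improvement.\<close>

lemma mills_derivative:
  "((\<lambda>x. std_normal_density x * x / (1 + x\<^sup>2)) has_real_derivative
     - (std_normal_density x * (1 - 2 / (1 + x\<^sup>2)\<^sup>2))) (at x)"
proof -
  have nz: "1 + x\<^sup>2 \<noteq> 0" by (metis add_pos_nonneg less_irrefl zero_le_power2 zero_less_one)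
  have "((\<lambda>x. std_normal_density x * (x / (1 + x\<^sup>2))) has_real_derivative
      (- x * std_normal_density x * 1) * (x / (1 + x\<^sup>2))
        + ((1 * (1 + x\<^sup>2) - x * (2 * x)) / ((1 + x\<^sup>2) * (1 + x\<^sup>2))) * std_normal_density x) (at x)"
    using nz by (intro DERIV_mult std_normal_density_has_derivative DERIV_ident)
      (auto intro!: derivative_eq_intros)
  moreover have "(- x * std_normal_density x * 1) * (x / (1 + x\<^sup>2))
        + ((1 * (1 + x\<^sup>2) - x * (2 * x)) / ((1 + x\<^sup>2) * (1 + x\<^sup>2))) * std_normal_density x
      = - (std_normal_density x * (1 - 2 / (1 + x\<^sup>2)\<^sup>2))"
  proof -
    have "x * (x / (1 + x\<^sup>2)) = 1 - 1 / (1 + x\<^sup>2)"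
      using nz by (simp add: field_simps power2_eq_square)
    moreover have "(1 * (1 + x\<^sup>2) - x * (2 * x)) / ((1 + x\<^sup>2) * (1 + x\<^sup>2)) = 2 / (1 + x\<^sup>2)\<^sup>2 - 1 / (1 + x\<^sup>2)"
      using nz by (simp add: divide_simps power2_eq_square) (simp add: algebra_simps)
    ultimately have "- std_normal_density x * (x * (x / (1 + x\<^sup>2)))
        + ((1 * (1 + x\<^sup>2) - x * (2 * x)) / ((1 + x\<^sup>2) * (1 + x\<^sup>2))) * std_normal_density x
      = - std_normal_density x * (1 - 1 / (1 + x\<^sup>2)) + (2 / (1 + x\<^sup>2)\<^sup>2 - 1 / (1 + x\<^sup>2)) * std_normal_density x"
      by (simp only:)
    also have "\<dots> = - (std_normal_density x * (1 - 2 / (1 + x\<^sup>2)\<^sup>2))"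
      by (simp add: algebra_simps)
    finally show ?thesis by (simp add: mult_ac)
  qed
  ultimately show ?thesis by simp
qed

lemma tendsto_std_normal_density: "(std_normal_density \<longlongrightarrow> 0) at_top"
  unfolding std_normal_density_def by real_asymp

lemma tendsto_mills: "((\<lambda>x. std_normal_density x * x / (1 + x\<^sup>2)) \<longlongrightarrow> 0) at_top"
  unfolding std_normal_density_def by real_asymp

lemma mills_ratio_lower:
  assumes "1 \<le> x"
  shows "std_normal_density x * x / (1 + x\<^sup>2) \<le> std_tail x"
proof -
  let ?g = "\<lambda>y::real. std_normal_density y * (1 - 2 / (1 + y\<^sup>2)\<^sup>2)"
  interpret prob_space std_normal_distribution
    by (rule prob_space_normal_density) simp
  \<comment> \<open>From 1 on the comparison integrand is nonnegative, as the fundamental theorem in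
    terms of nonnegative integrals requires.\<close>
  have le: "2 / (1 + y\<^sup>2)\<^sup>2 \<le> 1" if "x \<le> y" for y
  proof -
    have "1 \<le> y\<^sup>2" using that assms by (simp add: one_le_power)
    then have "2 \<le> (1 + y\<^sup>2)\<^sup>2" using power_mono[of 2 "1 + y\<^sup>2" 2] by simp
    then show ?thesis by (simp add: divide_le_eq_1)
  qed
  have d: "((\<lambda>x. - (std_normal_density x * x / (1 + x\<^sup>2))) has_real_derivative ?g y) (at y)" for y
    using DERIV_minus[OF mills_derivative, of y] by simp
  have "(\<integral>\<^sup>+y. ennreal (?g y) * indicator {x..} y \<partial>lborel) = ennreal (0 - - (std_normal_density x * x / (1 + x\<^sup>2)))"
    using tendsto_minus[OF tendsto_mills]
    by (intro nn_integral_FTC_atLeast[OF _ d]) (auto intro!: mult_nonneg_nonneg le)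
  moreover have "(\<integral>\<^sup>+y. ennreal (?g y) * indicator {x..} y \<partial>lborel)
      \<le> (\<integral>\<^sup>+y. ennreal (std_normal_density y) * indicator {x..} y \<partial>lborel)"
    by (intro nn_integral_mono mult_right_mono ennreal_leI)
      (auto intro!: mult_left_le)
  moreover have "\<dots> = emeasure std_normal_distribution {x..}"
    by (simp add: emeasure_density)
  ultimately show ?thesis by (simp add: emeasure_eq_measure)
qed

lemma ei_eq_std:
  assumes "0 \<le> s"
  shows "ei \<tau> m s = (\<integral>x. max (m + s * x - \<tau>) 0 \<partial>std_normal_distribution)"
proof (cases "s = 0")
  case True
  interpret prob_space std_normal_distribution
    by (rule prob_space_normal_density) simp
  show ?thesis using True by (simp add: ei_def prob_space del: space_density)
next
  case False
  have "ei \<tau> m s = (\<integral>x. max (x - \<tau>) 0 \<partial>normal_measure m s)"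
    using False by (simp add: ei_def normal_measure_def integral_density mult.commute)
  also have "\<dots> = (\<integral>x. max (m + s * x - \<tau>) 0 \<partial>std_normal_distribution)"
    by (subst normal_measure_eq_distr[OF assms], subst integral_distr) auto
  finally show ?thesis .
qed

lemma integrable_std_affine:
  "integrable std_normal_distribution (\<lambda>x. a + b * x)"
proof -
  interpret prob_space std_normal_distribution
    by (rule prob_space_normal_density) simp
  show ?thesis using integrable_std_normal_distribution_moment[of 1] by simp
qed

lemma integrable_std_max_affine:
  "integrable std_normal_distribution (\<lambda>x. max (a + b * x - c) 0)"
  using integrable_std_affine[of "a - c" b] by (auto intro!: integrable_max simp: algebra_simps)

lemma ei_nonneg: "0 \<le> ei \<tau> m s"
  by (auto simp: ei_def intro!: integral_nonneg_AE)

text \<open>On \<open>{x..}\<close> the improvement is at least its value at \<open>x\<close>, and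
  elsewhere it is at least 0, as in Markov's inequality.\<close>

lemma ei_ge_tail:
  assumes "0 \<le> s"
  shows "(s * x - (\<tau> - m)) * std_tail x \<le> ei \<tau> m s"
proof -
  interpret prob_space std_normal_distribution
    by (rule prob_space_normal_density) simp
  have "(s * x - (\<tau> - m)) * std_tail x = (\<integral>y. (s * x - (\<tau> - m)) * indicator {x..} y \<partial>std_normal_distribution)"
    by simp
  also have "\<dots> \<le> (\<integral>y. max (m + s * y - \<tau>) 0 \<partial>std_normal_distribution)"
  proof (rule integral_mono)
    show "integrable std_normal_distribution (\<lambda>y. (s * x - (\<tau> - m)) * indicator {x..} y)"
      by (intro integrable_mult_right integrable_const_bound[where B = 1]) auto
    show "(s * x - (\<tau> - m)) * indicator {x..} y \<le> max (m + s * y - \<tau>) 0" for y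
      using mult_left_mono[OF _ assms, of x y] by (auto simp: indicator_def)
  qed (rule integrable_std_max_affine)
  finally show ?thesis using ei_eq_std[OF assms] by simp
qed

text \<open>The expected improvement over \<open>s\<close> is the density at \<open>s\<close> minus
  \<open>s\<close> times the tail; the Mills bound for the tail gives the right-hand side.
  Integrating the derivative of that combination directly covers all \<open>s\<close> from 0 on,
  whereas \<open>mills_ratio_lower\<close> starts at 1.\<close>

lemma ei_std_upper:
  assumes "0 \<le> s"
  shows "ei s 0 1 \<le> std_normal_density s / (1 + s\<^sup>2)"
proof -
  let ?K = "\<lambda>x. s * (std_normal_density x * x / (1 + x\<^sup>2)) - std_normal_density x"
  let ?k = "\<lambda>x. std_normal_density x * (x - s * (1 - 2 / (1 + x\<^sup>2)\<^sup>2))"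
  have d: "(?K has_real_derivative ?k x) (at x)" for x
    by (rule derivative_eq_intros mills_derivative refl)+ (simp add: algebra_simps)
  have k: "max (x - s) 0 * std_normal_density x \<le> ?k x" "0 \<le> ?k x" if "s \<le> x" for x
  proof -
    have "s * (1 - 2 / (1 + x\<^sup>2)\<^sup>2) \<le> s" using assms by (intro mult_left_le) auto
    then have le: "std_normal_density x * (x - s) \<le> ?k x"
      by (intro mult_left_mono) auto
    have "0 \<le> std_normal_density x * (x - s)" using that by (intro mult_nonneg_nonneg) auto
    from this le show "0 \<le> ?k x" by (rule order_trans)
    show "max (x - s) 0 * std_normal_density x \<le> ?k x"
      using le that by (metis max.absorb1 diff_ge_0_iff_ge mult.commute)
  qed
  have nn: "(\<integral>\<^sup>+x. ennreal (?k x) * indicator {s..} x \<partial>lborel) = ennreal (s * 0 - 0 - ?K s)"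
  proof (rule nn_integral_FTC_atLeast[OF _ d])
    show "(?K \<longlongrightarrow> s * 0 - 0) at_top"
      by (intro tendsto_diff tendsto_mult tendsto_const tendsto_mills tendsto_std_normal_density)
  qed (auto intro!: k)
  have "ennreal (ei s 0 1) = (\<integral>\<^sup>+x. ennreal (max (x - s) 0 * std_normal_density x) \<partial>lborel)"
  proof -
    have "integrable lborel (\<lambda>x. max (x - s) 0 * std_normal_density x)"
      using integrable_std_max_affine[of 0 1 s]
      by (subst (asm) integrable_density) (auto simp: mult.commute)
    then show ?thesis
      by (subst nn_integral_eq_integral) (auto simp: ei_def)
  qed
  also have "\<dots> \<le> (\<integral>\<^sup>+x. ennreal (?k x) * indicator {s..} x \<partial>lborel)"
  proof (intro nn_integral_mono)
    fix x show "ennreal (max (x - s) 0 * std_normal_density x) \<le> ennreal (?k x) * indicator {s..} x"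
      using k[of x] by (cases "s \<le> x") (auto intro!: ennreal_leI)
  qed
  also note nn
  also have "s * 0 - 0 - ?K s = std_normal_density s / (1 + s\<^sup>2)"
  proof -
    have "1 + s\<^sup>2 \<noteq> 0" by (metis add_pos_nonneg less_irrefl zero_le_power2 zero_less_one)
    then show ?thesis by (simp add: field_simps power2_eq_square)
  qed
  finally show ?thesis
    by (subst (asm) ennreal_le_iff) auto
qed

section \<open>Expected maxima and ranges of Gaussian families\<close>

lemma integrable_Max_image:
  fixes X :: "'i \<Rightarrow> 'a \<Rightarrow> real"
  assumes "finite I" "I \<noteq> {}" and "\<And>i. i \<in> I \<Longrightarrow> integrable M (X i)"
  shows "integrable M (\<lambda>\<omega>. Max ((\<lambda>i. X i \<omega>) ` I))"
  using assms by (induction I rule: finite_ne_induct) auto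

lemma integrable_Min_image:
  fixes X :: "'i \<Rightarrow> 'a \<Rightarrow> real"
  assumes "finite I" "I \<noteq> {}" and "\<And>i. i \<in> I \<Longrightarrow> integrable M (X i)"
  shows "integrable M (\<lambda>\<omega>. Min ((\<lambda>i. X i \<omega>) ` I))"
  using assms by (induction I rule: finite_ne_induct) auto

lemma Max_uminus_image:
  fixes x :: "'i \<Rightarrow> real"
  assumes "finite I" "I \<noteq> {}"
  shows "Max ((\<lambda>i. - x i) ` I) = - Min (x ` I)"
  using assms by (induction I rule: finite_ne_induct) (auto simp: minus_min_eq_max)

lemma Min_uminus_image:
  fixes x :: "'i \<Rightarrow> real"
  assumes "finite I" "I \<noteq> {}"
  shows "Min ((\<lambda>i. - x i) ` I) = - Max (x ` I)"
  using assms by (induction I rule: finite_ne_induct) (auto simp: minus_max_eq_min)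

context centered_gaussian
begin

text \<open>A union bound, valid for any correlation: the maximum exceeds \<open>B\<close> by at
  most the sum over all arms of the excess over \<open>s\<close> standard deviations, and by scaling
  each excess has expectation \<open>sd (r n) * ei s 0 1\<close>.\<close>

lemma expected_Max_le:
  fixes r :: "'n \<Rightarrow> real ^ 'n" and m :: "'n \<Rightarrow> real"
  assumes B: "\<And>n. m n + sd (r n) * s \<le> B" and \<sigma>: "\<And>n. sd (r n) \<le> \<sigma>"
  shows "(\<integral>g. Max (range (\<lambda>n. m n + r n \<bullet> g)) \<partial>\<nu>) \<le> B + \<sigma> * (real CARD('n) * ei s 0 1)"
proof -
  let ?e = "\<lambda>n g. max (0 + r n \<bullet> g - sd (r n) * s) 0"
  have int: "integrable \<nu> (?e n)" for n by (intro integrable_max) auto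
  have "(\<integral>g. Max (range (\<lambda>n. m n + r n \<bullet> g)) \<partial>\<nu>) \<le> (\<integral>g. B + (\<Sum>n\<in>UNIV. ?e n g) \<partial>\<nu>)"
  proof (rule integral_mono)
    show "integrable \<nu> (\<lambda>g. Max (range (\<lambda>n. m n + r n \<bullet> g)))"
      by (rule integrable_Max_image) auto
    show "integrable \<nu> (\<lambda>g. B + (\<Sum>n\<in>UNIV. ?e n g))" using int by simp
    fix g
    have "m n + r n \<bullet> g \<le> B + (\<Sum>n\<in>UNIV. ?e n g)" for n
    proof -
      have "?e n g \<le> (\<Sum>n\<in>UNIV. ?e n g)" by (rule member_le_sum) auto
      then show ?thesis using B[of n] by linarith
    qed
    then show "Max (range (\<lambda>n. m n + r n \<bullet> g)) \<le> B + (\<Sum>n\<in>UNIV. ?e n g)" by auto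
  qed
  also have "\<dots> = B + (\<Sum>n\<in>UNIV. \<integral>g. ?e n g \<partial>\<nu>)"
    using int by (simp add: prob_space[simplified])
  also have "(\<Sum>n\<in>UNIV. \<integral>g. ?e n g \<partial>\<nu>) = (\<Sum>n\<in>UNIV. sd (r n) * ei s 0 1)"
  proof (rule sum.cong[OF refl])
    fix n
    have "(\<integral>g. ?e n g \<partial>\<nu>) = (\<integral>x. max (0 + sd (r n) * x - sd (r n) * s) 0 \<partial>std_normal_distribution)"
      by (rule integral_inner[of "\<lambda>y. max (0 + y - sd (r n) * s) 0"]) simp
    also have "\<dots> = (\<integral>x. sd (r n) * max (0 + 1 * x - s) 0 \<partial>std_normal_distribution)"
      by (intro Bochner_Integration.integral_cong refl)
        (simp add: max_mult_distrib_left right_diff_distrib[symmetric])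
    finally show "(\<integral>g. ?e n g \<partial>\<nu>) = sd (r n) * ei s 0 1"
      by (simp add: ei_eq_std)
  qed
  also have "\<dots> \<le> (\<Sum>n\<in>(UNIV::'n set). \<sigma> * ei s 0 1)"
    by (intro sum_mono mult_right_mono \<sigma> ei_nonneg)
  finally show ?thesis by (simp add: algebra_simps)
qed

lemma sd_uminus[simp]: "sd (- u) = sd u"
  by (simp add: sd_def matrix_vector_mult_uminus)

text \<open>Adding the two hypotheses on \<open>U\<close> at the arm of largest standard deviation bounds that
  deviation by \<open>(hi - lo + 2 * U) / (2 * s)\<close>, which absorbs the additive error of
  \<open>expected_Max_le\<close> into a factor.\<close>

lemma expected_range_le:
  fixes r :: "'n \<Rightarrow> real ^ 'n" and m :: "'n \<Rightarrow> real"
  assumes up: "\<And>n. m n - hi + sd (r n) * s \<le> U" and down: "\<And>n. lo - m n + sd (r n) * s \<le> U"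
    and "0 < s"
  shows "(\<integral>g. Max (range (\<lambda>n. m n + r n \<bullet> g)) - Min (range (\<lambda>n. m n + r n \<bullet> g)) \<partial>\<nu>)
    \<le> (1 + real CARD('n) * ei s 0 1 / s) * (hi - lo + 2 * U)"
proof -
  define \<sigma> where "\<sigma> = Max (range (\<lambda>n. sd (r n)))"
  have \<sigma>: "sd (r n) \<le> \<sigma>" for n by (simp add: \<sigma>_def)
  have "\<sigma> \<in> range (\<lambda>n. sd (r n))" unfolding \<sigma>_def by (rule Max_in) auto
  then obtain k where k: "\<sigma> = sd (r k)" by auto
  have \<sigma>s: "2 * \<sigma> * s \<le> hi - lo + 2 * U" using up[of k] down[of k] by (simp add: k)
  define e where "e = real CARD('n) * ei s 0 1"
  have e: "0 \<le> e" by (simp add: e_def ei_nonneg)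
  have 1: "(\<integral>g. Max (range (\<lambda>n. m n + r n \<bullet> g)) \<partial>\<nu>) \<le> (hi + U) + \<sigma> * e"
    unfolding e_def
  proof (rule expected_Max_le)
    show "m n + sd (r n) * s \<le> hi + U" for n using up[of n] by simp
  qed (rule \<sigma>)
  have 2: "(\<integral>g. Max (range (\<lambda>n. - m n + (- r n) \<bullet> g)) \<partial>\<nu>) \<le> (U - lo) + \<sigma> * e"
    unfolding e_def
  proof (rule expected_Max_le)
    show "- m n + sd (- r n) * s \<le> U - lo" for n using down[of n] by simp
  qed (simp add: \<sigma>)
  \<comment> \<open>The lower end is the upper end of the negated family, so that bound 2 applies to
    it.\<close>
  have Min_eq: "Min (range (\<lambda>n. m n + r n \<bullet> g)) = - Max (range (\<lambda>n. - m n + (- r n) \<bullet> g))" for g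
  proof -
    have "(\<lambda>n. - m n + (- r n) \<bullet> g) = (\<lambda>n. - (m n + r n \<bullet> g))" by auto
    then have "Max (range (\<lambda>n. - m n + (- r n) \<bullet> g)) = - Min (range (\<lambda>n. m n + r n \<bullet> g))"
      by (simp only:) (rule Max_uminus_image, auto)
    then show ?thesis by (simp only: minus_minus)
  qed
  have "(\<integral>g. Max (range (\<lambda>n. m n + r n \<bullet> g)) - Min (range (\<lambda>n. m n + r n \<bullet> g)) \<partial>\<nu>)
    = (\<integral>g. Max (range (\<lambda>n. m n + r n \<bullet> g)) \<partial>\<nu>) + (\<integral>g. Max (range (\<lambda>n. - m n + (- r n) \<bullet> g)) \<partial>\<nu>)"
    unfolding Min_eq diff_minus_eq_add by (intro Bochner_Integration.integral_add integrable_Max_image) auto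
  also have "\<dots> \<le> hi - lo + 2 * U + 2 * \<sigma> * e" using 1 2 by simp
  also have "2 * \<sigma> * e \<le> (e / s) * (hi - lo + 2 * U)"
    using mult_left_mono[OF \<sigma>s, of "e / s"] e \<open>0 < s\<close> by (simp add: mult_ac)
  finally show ?thesis by (simp add: e_def algebra_simps)
qed

end

section \<open>The numerical estimate\<close>

text \<open>Write \<open>q = ln (real T)\<close>. The logarithm subtracted in \<open>L\<close>
  leaves \<open>3 * q powr (3/2) / T\<close> in the exponential. Mills' ratio contributes a factor
  of order \<open>1 / sqrt (2 * q)\<close>, so a multiple of \<open>q / T\<close> remains; the
  constant 3 pays for all numerical losses and for passing from \<open>T\<close> to
  \<open>T - 1\<close>.\<close>

lemma tail_level_bounds:
  fixes N T :: nat
  defines "s \<equiv> sqrt (2 * ln (real N))"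
    and "L \<equiv> sqrt (2 * (ln (real T) - ln (3 * ln (real T) powr (3/2))))"
  defines "\<delta> \<equiv> real N * ei s 0 1 / s"
  assumes T: "500 \<le> T" and TN: "T \<le> N"
  shows "ln (real T) / (sqrt pi * (real T - 1)) \<le> std_tail ((1 + \<delta>) * L)"
    and "(1 + \<delta>) * L \<le> s" and "0 \<le> L" and "0 \<le> \<delta>" and "0 < s"
proof -
  define q where "q = ln (real T)"
  define l where "l = sqrt (2 * q)"
  have e6: "exp 6 \<le> (500::real)"
  proof -
    have "exp (1::real) ^ 6 \<le> (2.72::real) ^ 6"
      using e_less_272 by (intro power_mono) auto
    then show ?thesis by (simp add: exp_of_nat_mult[symmetric] power_divide)
  qed
  \<comment> \<open>The exponential of 6 is about 403, below the least admissible
    \<open>T\<close>.\<close>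
  have q: "6 \<le> q"
  proof -
    have "exp 6 \<le> real T" using e6 T by linarith
    then show ?thesis unfolding q_def using ln_ge_iff[of "real T" 6] T by simp
  qed
  have l2: "l\<^sup>2 = 2 * q" using q by (simp add: l_def)
  have l3: "3 \<le> l" using q by (simp add: l_def real_le_rsqrt)
  have qN: "q \<le> ln (real N)" using T TN by (simp add: q_def)
  have ls: "l \<le> s" using qN q by (simp add: l_def s_def)
  with l3 show s0: "0 < s" by simp
  have s2: "s\<^sup>2 = 2 * ln (real N)" using qN q by (simp add: s_def)
  have lnq: "ln (3 * q powr (3/2)) = ln 3 + 3/2 * ln q"
    using q by (simp add: ln_mult ln_powr)
  have ln3: "1 \<le> ln (3::real)"
    using e_less_272 ln_ge_iff[of "3::real" 1] by simp
  \<comment> \<open>The logarithm subtracted in \<open>L\<close>, at \<open>q = 6\<close>. Doubling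
    turns the claim into \<open>ln 1944 \<le> 8\<close>, as 1944 is the product of 3 squared and 6
    cubed.\<close>
  have ln36: "ln 3 + 3/2 * ln (6::real) \<le> 4"
  proof -
    have "(13/8::real) \<le> exp (1/2)"
      using exp_lower_Taylor_quadratic[of "1/2::real"] by (simp add: power2_eq_square)
    then have "(13/8) ^ 16 \<le> exp (1/2::real) ^ 16" by (intro power_mono) auto
    also have "\<dots> = exp 8" by (simp add: exp_of_nat_mult[symmetric])
    finally have "(1944::real) \<le> exp 8" by (simp add: power_divide)
    then have "ln (1944::real) \<le> ln (exp 8)" by (subst ln_le_cancel_iff) auto
    then have "ln (1944::real) \<le> 8" by simp
    moreover have "ln (1944::real) = 2 * ln 3 + 3 * ln 6"
    proof -
      have "ln ((3::real) ^ 2 * 6 ^ 3) = ln (3 ^ 2) + ln (6 ^ 3)" by (subst ln_mult) simp_all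
      also have "\<dots> = real 2 * ln 3 + real 3 * ln 6"
        using ln_realpow[of "3::real" 2] ln_realpow[of "6::real" 3] by (simp only:)
      finally show ?thesis by simp
    qed
    ultimately show ?thesis by simp
  qed
  \<comment> \<open>The tangent of \<open>ln\<close> at 6 carries the estimate from
    \<open>q = 6\<close> to all larger \<open>q\<close>.\<close>
  have lnq1: "ln q \<le> ln 6 + (q - 6) / 6"
    using ln_le_minus_one[of "q / 6"] q by (simp add: ln_div diff_divide_distrib)
  have lnq2: "0 \<le> ln q" using q by simp
  have Lr: "2 \<le> q - ln (3 * q powr (3/2))" "q - ln (3 * q powr (3/2)) \<le> q - 1"
  proof -
    show "q - ln (3 * q powr (3/2)) \<le> q - 1" unfolding lnq using lnq2 ln3 by simp
    show "2 \<le> q - ln (3 * q powr (3/2))"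
      unfolding lnq using lnq1 ln36 q by (simp add: field_simps)
  qed
  have Ldef: "L = sqrt (2 * (q - ln (3 * q powr (3/2))))" by (simp add: L_def q_def)
  have L2: "L\<^sup>2 = 2 * (q - ln (3 * q powr (3/2)))"
    unfolding Ldef using Lr by (intro real_sqrt_pow2) simp
  have L2_lower: "4 \<le> L\<^sup>2" and L2_upper: "L\<^sup>2 \<le> l\<^sup>2 - 2"
    using Lr unfolding L2 l2 by simp_all
  show L0: "0 \<le> L" unfolding Ldef using Lr by simp
  show d0: "0 \<le> \<delta>" unfolding \<delta>_def using s0 by (simp add: ei_nonneg)
  have dens: "std_normal_density x = exp (- (x\<^sup>2) / 2) / sqrt (2 * pi)" for x
    by (simp add: std_normal_density_def)
  have sq2pi: "5/2 \<le> sqrt (2 * pi)"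
    using pi_approx by (intro real_le_rsqrt) (simp add: power2_eq_square)
  have l34: "34/10 \<le> l" unfolding l_def using q by (intro real_le_rsqrt) (simp add: power2_eq_square)
  \<comment> \<open>The level \<open>s\<close> is chosen such that \<open>N\<close> times the
    density at \<open>s\<close> is \<open>1 / sqrt (2 * pi)\<close>; hence \<delta> decays like the
    inverse cube of \<open>s\<close>, and \<open>l \<le> s\<close> allows \<open>l\<close> in place
    of \<open>s\<close>.\<close>
  have dle: "\<delta> * (l * (1 + l\<^sup>2)) \<le> 4/10"
  proof -
    have "real N * std_normal_density s = 1 / sqrt (2 * pi)"
      unfolding dens s2 using T TN by (simp add: exp_minus)
    moreover have "real N * ei s 0 1 \<le> real N * (std_normal_density s / (1 + s\<^sup>2))"
      using s0 by (intro mult_left_mono ei_std_upper) auto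
    ultimately have "real N * ei s 0 1 \<le> 1 / sqrt (2 * pi) / (1 + s\<^sup>2)" by simp
    moreover have p: "0 < 1 + s\<^sup>2" by (simp add: add_pos_nonneg)
    ultimately have "real N * ei s 0 1 * (1 + s\<^sup>2) \<le> 1 / sqrt (2 * pi)"
      by (simp add: pos_le_divide_eq mult_ac)
    also have "\<dots> \<le> 1 / (5/2)"
      using sq2pi by (intro divide_left_mono) auto
    finally have "\<delta> * (s * (1 + s\<^sup>2)) \<le> 4/10" using s0 by (simp add: \<delta>_def)
    moreover have "\<delta> * (l * (1 + l\<^sup>2)) \<le> \<delta> * (s * (1 + s\<^sup>2))"
      using ls l3 d0 by (intro mult_left_mono mult_mono add_left_mono power_mono) auto
    ultimately show ?thesis by simp
  qed
  have dl: "\<delta> * l\<^sup>2 \<le> 118/1000"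
  proof -
    have "(\<delta> * l\<^sup>2) * (34/10) \<le> (\<delta> * l\<^sup>2) * l"
      using l34 d0 by (intro mult_left_mono) auto
    also have "\<dots> \<le> \<delta> * (l * (1 + l\<^sup>2))"
      using d0 l3 by (simp add: algebra_simps)
    finally show ?thesis using dle by simp
  qed
  have d01: "\<delta> \<le> 1/100"
  proof -
    have "\<delta> * 12 \<le> \<delta> * l\<^sup>2" using d0 q l2 by (intro mult_left_mono) auto
    then show ?thesis using dl by simp
  qed
  define L' where "L' = (1 + \<delta>) * L"
  have L'0: "0 \<le> L'" unfolding L'_def using L0 d0 by simp
  \<comment> \<open>Half the increase of the squared level caused by the factor
    \<open>1 + \<delta>\<close>. It is at most 0.12, which costs at most the factor 0.88 in the
    density.\<close>
  define \<eta> where "\<eta> = L\<^sup>2 * (\<delta> + \<delta>\<^sup>2 / 2)"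
  have L'2: "L'\<^sup>2 = L\<^sup>2 + 2 * \<eta>"
    by (simp add: L'_def \<eta>_def power2_eq_square algebra_simps)
  have \<eta>0: "0 \<le> \<eta>" unfolding \<eta>_def using d0 by simp
  have \<eta>: "\<eta> \<le> 12/100"
  proof -
    have "\<delta>\<^sup>2 \<le> \<delta> * (1/100)" unfolding power2_eq_square using d0 d01 by (intro mult_left_mono) auto
    then have "\<eta> \<le> L\<^sup>2 * (\<delta> * (1005/1000))" unfolding \<eta>_def by (intro mult_left_mono) auto
    also have "\<dots> \<le> l\<^sup>2 * (\<delta> * (1005/1000))" using L2_upper d0 by (intro mult_right_mono) auto
    finally show ?thesis using dl by (simp add: mult_ac)
  qed
  have L'l: "L' \<le> l"
  proof (rule power2_le_imp_le)
    show "L'\<^sup>2 \<le> l\<^sup>2" using L'2 L2_upper \<eta> by linarith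
  qed (use l3 in simp)
  then show "(1 + \<delta>) * L \<le> s" using ls by (simp add: L'_def)
  have L'4: "4 \<le> L'\<^sup>2" using L'2 L2_lower \<eta>0 by linarith
  have L'1: "1 \<le> L'" using L'4 L'0 by (intro power2_le_imp_le[of 1 L']) auto
  \<comment> \<open>The factor 0.8 is the value of x^2 / (1 + x^2) at x = 2, and \<open>L'\<close>
    is at least 2.\<close>
  have ratio: "8/10 / l \<le> L' / (1 + L'\<^sup>2)"
  proof -
    have "8/10 * (1 + L'\<^sup>2) \<le> L' * L'" using L'4 by (simp add: power2_eq_square)
    also have "\<dots> \<le> L' * l" using L'l L'0 by (intro mult_left_mono) auto
    finally show ?thesis using l3 by (simp add: divide_le_eq pos_le_divide_eq add_pos_nonneg mult_ac)
  qed
  have expL: "exp (- (L\<^sup>2) / 2) = 3 * (q * sqrt q) / real T"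
  proof -
    have "exp (- (L\<^sup>2) / 2) = exp (ln (3 * q powr (3/2)) - q)"
      unfolding L2 by simp
    also have "\<dots> = 3 * q powr (3/2) / real T"
      using q T by (simp add: exp_diff q_def)
    also have "q powr (3/2) = q * sqrt q"
      using q powr_add[of q 1 "1/2"] by (simp add: powr_half_sqrt)
    finally show ?thesis .
  qed
  have "3 * (q * sqrt q) / real T * (88/100) / sqrt (2 * pi) \<le> std_normal_density L'"
  proof -
    have "- (L'\<^sup>2) / 2 = - (L\<^sup>2) / 2 + (- \<eta>)" unfolding L'2 by simp
    then have "exp (- (L'\<^sup>2) / 2) = exp (- (L\<^sup>2) / 2) * exp (- \<eta>)" by (simp only: exp_add)
    moreover have "88/100 \<le> exp (- \<eta>)" using exp_ge_add_one_self[of "- \<eta>"] \<eta> by linarith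
    ultimately have "exp (- (L\<^sup>2) / 2) * (88/100) \<le> exp (- (L'\<^sup>2) / 2)" by simp
    then show ?thesis unfolding dens expL by (intro divide_right_mono) auto
  qed
  then have "3 * (q * sqrt q) / real T * (88/100) / sqrt (2 * pi) * (8/10 / l)
      \<le> std_normal_density L' * (L' / (1 + L'\<^sup>2))"
    using ratio l3 q by (intro mult_mono) auto
  also have "\<dots> \<le> std_tail L'" using mills_ratio_lower[OF L'1] by simp
  also have "3 * (q * sqrt q) / real T * (88/100) / sqrt (2 * pi) * (8/10 / l) = q / sqrt pi * (1056/1000 / real T)"
    using q T by (simp add: l_def real_sqrt_mult field_simps)
  finally have "q / sqrt pi * (1056/1000 / real T) \<le> std_tail L'" .
  moreover have "q / sqrt pi * (1 / (real T - 1)) \<le> q / sqrt pi * (1056/1000 / real T)"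
    using q T by (intro mult_left_mono) (auto simp: field_simps)
  ultimately show "ln (real T) / (sqrt pi * (real T - 1)) \<le> std_tail ((1 + \<delta>) * L)"
    by (simp add: L'_def q_def)
qed

section \<open>Policies and the posterior\<close>

abbreviation transcript_space :: "nat \<Rightarrow> (nat \<Rightarrow> 'n \<times> real) measure" where
  "transcript_space t \<equiv> PiM {1..t} (\<lambda>_. count_space UNIV \<Otimes>\<^sub>M borel)"

text \<open>The actions and values recorded when the policy is run on the arm values \<open>f\<close>: \<open>\<gamma> t\<close>
  chooses action number \<open>t + 1\<close>.\<close>

primrec transcript :: "(nat \<Rightarrow> (nat \<Rightarrow> 'n \<times> real) \<Rightarrow> 'n) \<Rightarrow> nat \<Rightarrow> real ^ 'n \<Rightarrow> nat \<Rightarrow> 'n \<times> real" where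
  "transcript \<gamma> 0 f = (\<lambda>_. undefined)"
| "transcript \<gamma> (Suc t) f = (transcript \<gamma> t f)(Suc t := (\<gamma> t (transcript \<gamma> t f), f $ \<gamma> t (transcript \<gamma> t f)))"

definition act :: "(nat \<Rightarrow> (nat \<Rightarrow> 'n \<times> real) \<Rightarrow> 'n) \<Rightarrow> nat \<Rightarrow> real ^ 'n \<Rightarrow> 'n" where
  "act \<gamma> k f = fst (transcript \<gamma> k f k)"

definition seen :: "(nat \<Rightarrow> (nat \<Rightarrow> 'n \<times> real) \<Rightarrow> 'n) \<Rightarrow> nat \<Rightarrow> real ^ 'n \<Rightarrow> 'n set" where
  "seen \<gamma> t f = (\<lambda>k. act \<gamma> k f) ` {1..t}"

lemma act_Suc: "act \<gamma> (Suc t) f = \<gamma> t (transcript \<gamma> t f)"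
  by (simp add: act_def)

lemma transcript_eq: "transcript \<gamma> t f = (\<lambda>k\<in>{1..t}. (act \<gamma> k f, f $ act \<gamma> k f))"
proof (induction t)
  case (Suc t)
  show ?case
    unfolding transcript.simps act_Suc[symmetric] by (subst Suc) (auto simp: fun_eq_iff)
qed auto

lemma seen_Suc: "seen \<gamma> (Suc t) f = insert (act \<gamma> (Suc t) f) (seen \<gamma> t f)"
  by (simp add: seen_def atLeastAtMostSuc_conv)

lemma transcript_at: "k \<in> {1..t} \<Longrightarrow> transcript \<gamma> t f k = (act \<gamma> k f, f $ act \<gamma> k f)"
  by (subst transcript_eq) simp

text \<open>The policy reacts only to values of arms it has played, so changing the other arms
  cannot alter the run. This is what makes resampling compatible with adaptive choices.\<close>

lemma transcript_cong:
  assumes "\<And>i. i \<in> seen \<gamma> t f \<Longrightarrow> f' $ i = f $ i"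
  shows "transcript \<gamma> t f' = transcript \<gamma> t f"
  using assms
proof (induction t)
  case (Suc t)
  have "transcript \<gamma> t f' = transcript \<gamma> t f" using Suc by (auto simp: seen_Suc)
  moreover have "f' $ act \<gamma> (Suc t) f = f $ act \<gamma> (Suc t) f" using Suc by (auto simp: seen_Suc)
  ultimately show ?case by (simp add: act_Suc)
qed simp

lemma act_eq_transcript: "k \<in> {1..t} \<Longrightarrow> act \<gamma> k f = fst (transcript \<gamma> t f k)"
  by (simp add: transcript_at)

lemma seen_eq_transcript: "seen \<gamma> t f = (\<lambda>k. fst (transcript \<gamma> t f k)) ` {1..t}"
  unfolding seen_def by (intro image_cong) (auto simp: act_eq_transcript)

lemma seen_cong:
  assumes "\<And>i. i \<in> seen \<gamma> t f \<Longrightarrow> f' $ i = f $ i"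
  shows "seen \<gamma> t f' = seen \<gamma> t f"
  unfolding seen_eq_transcript using transcript_cong[OF assms] by simp

locale gaussian_policy = centered_gaussian \<nu> S
  for \<nu> :: "(real ^ 'n) measure" and S +
  fixes \<gamma> :: "nat \<Rightarrow> (nat \<Rightarrow> 'n \<times> real) \<Rightarrow> 'n"
  assumes \<gamma>_measurable[measurable]: "\<gamma> t \<in> transcript_space t \<rightarrow>\<^sub>M count_space UNIV"
begin

lemma transcript_measurable[measurable]: "transcript \<gamma> t \<in> borel \<rightarrow>\<^sub>M transcript_space t"
proof (induction t)
  case 0
  have "transcript \<gamma> 0 = (\<lambda>f. \<lambda>k\<in>{1..0}. undefined)" by (auto simp: fun_eq_iff)
  then show ?case by (simp add: space_PiM measurable_const)
next
  case (Suc t)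
  note [measurable] = Suc
  have [measurable]: "(\<lambda>f. f $ \<gamma> t (transcript \<gamma> t f)) \<in> borel_measurable borel"
    by (rule measurable_compose_countable[where f = "\<lambda>n f. f $ n"]) measurable
  have "(\<lambda>f. (transcript \<gamma> t f)(Suc t := (\<gamma> t (transcript \<gamma> t f), f $ \<gamma> t (transcript \<gamma> t f)))) \<in> borel \<rightarrow>\<^sub>M transcript_space (Suc t)"
  proof (rule measurable_fun_upd[where J = "{1..t}"])
    show "{1..Suc t} = {1..t} \<union> {Suc t}" by auto
  qed measurable
  then show ?case unfolding transcript.simps .
qed

lemma act_measurable[measurable]: "act \<gamma> (Suc t) \<in> borel \<rightarrow>\<^sub>M count_space UNIV"
  unfolding act_Suc by measurable

lemma seen_measurable[measurable]: "seen \<gamma> t \<in> borel \<rightarrow>\<^sub>M count_space UNIV"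
proof (induction t)
  case 0
  then show ?case by (simp add: seen_def)
next
  case (Suc t)
  note [measurable] = Suc
  show ?case unfolding seen_Suc
    by (rule measurable_compose_countable[where f = "\<lambda>n f. insert n (seen \<gamma> t f)"]) measurable
qed

abbreviation "posterior t f g \<equiv> resample (seen \<gamma> t f) f g"

lemma transcript_posterior[simp]: "transcript \<gamma> t (posterior t f g) = transcript \<gamma> t f"
  by (rule transcript_cong) (rule resample_observed)

lemma posterior_measurable[measurable]:
  "(\<lambda>x. posterior t (fst x) (snd x)) \<in> borel_measurable (borel \<Otimes>\<^sub>M borel)"
  by (rule measurable_compose_countable[where f = "\<lambda>I x. resample I (fst x) (snd x)"]) measurable

text \<open>Conditioning on the set of arms seen reduces to the non-adaptive case: whether that set
  equals \<open>I\<close> depends only on the coordinates in \<open>I\<close>, which resampling preserves.\<close>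

theorem distr_posterior:
  "distr (\<nu> \<Otimes>\<^sub>M \<nu>) borel (\<lambda>x. posterior t (fst x) (snd x)) = \<nu>"
proof (rule measure_eqI)
  show "sets (distr (\<nu> \<Otimes>\<^sub>M \<nu>) borel (\<lambda>x. posterior t (fst x) (snd x))) = sets \<nu>"
    by (simp add: sets_eq)
  fix B assume "B \<in> sets (distr (\<nu> \<Otimes>\<^sub>M \<nu>) borel (\<lambda>x. posterior t (fst x) (snd x)))"
  then have [measurable]: "B \<in> sets borel" by simp
  define h where "h I f = (indicator B f * indicator {I} (seen \<gamma> t f) :: ennreal)" for I f
  have [measurable]: "h I \<in> borel_measurable borel" for I
    unfolding h_def by measurable
  have *: "(\<Sum>I\<in>UNIV. c I * indicator {I} J) = c J" for c :: "'n set \<Rightarrow> ennreal" and J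
    by (simp add: indicator_def if_distrib cong: if_cong)
  have seen_iff: "seen \<gamma> t (resample I f g) = I \<longleftrightarrow> seen \<gamma> t f = I" for I f g
    using seen_cong[of \<gamma> t f "resample I f g"] seen_cong[of \<gamma> t "resample I f g" f]
    by (metis resample_observed)
  have "emeasure \<nu> B = (\<integral>\<^sup>+f. (\<Sum>I\<in>UNIV. h I f) \<partial>\<nu>)"
    unfolding h_def by (simp add: *[of "\<lambda>_. indicator B _"])
  also have "\<dots> = (\<Sum>I\<in>UNIV. \<integral>\<^sup>+f. h I f \<partial>\<nu>)"
    by (rule nn_integral_sum) measurable
  also have "\<dots> = (\<Sum>I\<in>UNIV. \<integral>\<^sup>+x. h I (resample I (fst x) (snd x)) \<partial>(\<nu> \<Otimes>\<^sub>M \<nu>))"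
  proof (rule sum.cong[OF refl])
    fix I
    show "(\<integral>\<^sup>+f. h I f \<partial>\<nu>) = (\<integral>\<^sup>+x. h I (resample I (fst x) (snd x)) \<partial>(\<nu> \<Otimes>\<^sub>M \<nu>))"
      by (subst distr_resample[of I, symmetric], subst nn_integral_distr) measurable
  qed
  also have "\<dots> = (\<integral>\<^sup>+x. (\<Sum>I\<in>UNIV. h I (resample I (fst x) (snd x))) \<partial>(\<nu> \<Otimes>\<^sub>M \<nu>))"
    by (rule nn_integral_sum[symmetric]) measurable
  also have "\<dots> = (\<integral>\<^sup>+x. indicator B (posterior t (fst x) (snd x)) \<partial>(\<nu> \<Otimes>\<^sub>M \<nu>))"
  proof (rule nn_integral_cong)
    fix x
    have "h I (resample I (fst x) (snd x)) = indicator B (resample I (fst x) (snd x)) * indicator {I} (seen \<gamma> t (fst x))" for I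
      using seen_iff[of I "fst x" "snd x"] by (auto simp: h_def indicator_def)
    then show "(\<Sum>I\<in>UNIV. h I (resample I (fst x) (snd x))) = indicator B (posterior t (fst x) (snd x))"
      by (simp add: *)
  qed
  also have "\<dots> = emeasure (distr (\<nu> \<Otimes>\<^sub>M \<nu>) borel (\<lambda>x. posterior t (fst x) (snd x))) B"
    by (subst nn_integral_indicator[symmetric], simp, subst nn_integral_distr) auto
  finally show "emeasure (distr (\<nu> \<Otimes>\<^sub>M \<nu>) borel (\<lambda>x. posterior t (fst x) (snd x))) B = emeasure \<nu> B" ..
qed


text \<open>The tower property: \<open>posterior t f g\<close> with \<open>g\<close> random plays
  the role of the conditional law given the run on \<open>f\<close>, and averaging over
  \<open>f\<close> restores the prior by \<open>distr_posterior\<close>.\<close>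

lemma
  fixes h :: "real ^ 'n \<Rightarrow> real"
  assumes h: "integrable \<nu> h"
  shows integral_posterior: "(\<integral>f. \<integral>g. h (posterior t f g) \<partial>\<nu> \<partial>\<nu>) = (\<integral>f. h f \<partial>\<nu>)"
    and integrable_integral_posterior: "integrable \<nu> (\<lambda>f. \<integral>g. h (posterior t f g) \<partial>\<nu>)"
proof -
  interpret P: pair_prob_space \<nu> \<nu> ..
  have h': "integrable (distr (\<nu> \<Otimes>\<^sub>M \<nu>) borel (\<lambda>x. posterior t (fst x) (snd x))) h"
    unfolding distr_posterior by (rule h)
  have hm[measurable]: "h \<in> borel_measurable borel"
    using borel_measurable_integrable[OF h] by (simp add: measurable_cong_sets[OF sets_eq refl])
  have int: "integrable (\<nu> \<Otimes>\<^sub>M \<nu>) (\<lambda>x. h (posterior t (fst x) (snd x)))"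
    using h' by (subst (asm) integrable_distr_eq) auto
  from P.integrable_fst'[OF int] show "integrable \<nu> (\<lambda>f. \<integral>g. h (posterior t f g) \<partial>\<nu>)" by simp
  have "(\<integral>f. h f \<partial>\<nu>) = (\<integral>x. h (posterior t (fst x) (snd x)) \<partial>(\<nu> \<Otimes>\<^sub>M \<nu>))"
    by (subst distr_posterior[of t, symmetric], subst integral_distr) auto
  also have "\<dots> = (\<integral>f. \<integral>g. h (posterior t f g) \<partial>\<nu> \<partial>\<nu>)"
    by (subst P.integral_fst'[OF int, symmetric]) simp
  finally show "(\<integral>f. \<integral>g. h (posterior t f g) \<partial>\<nu> \<partial>\<nu>) = (\<integral>f. h f \<partial>\<nu>)" ..
qed

end

text \<open>Doob-Dynkin factorisation for a finite-valued map. The sets \<open>C n\<close> are known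
  to partition only the image of \<open>X\<close>, which may fail to be measurable; so
  \<open>g\<close> is built by nested case distinctions and is prescribed only where exactly one
  \<open>C n\<close> contains the point.\<close>

lemma measurable_vimage_algebra_factor:
  fixes a :: "'a \<Rightarrow> 'n :: finite"
  assumes a: "a \<in> vimage_algebra \<Omega> X P \<rightarrow>\<^sub>M count_space UNIV" and X: "X \<in> \<Omega> \<rightarrow> space P"
  shows "\<exists>g \<in> P \<rightarrow>\<^sub>M count_space UNIV. \<forall>\<omega>\<in>\<Omega>. a \<omega> = g (X \<omega>)"
proof -
  have "\<exists>C\<in>sets P. a -` {n} \<inter> \<Omega> = X -` C \<inter> \<Omega>" for n
    using measurable_sets[OF a, of "{n}"] by (auto simp: sets_vimage_algebra2[OF X])
  then obtain C where C: "\<And>n. C n \<in> sets P" "\<And>n. a -` {n} \<inter> \<Omega> = X -` C n \<inter> \<Omega>" by metis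
  have "\<exists>g \<in> P \<rightarrow>\<^sub>M count_space UNIV. \<forall>y. \<forall>n\<in>I. (\<forall>m. y \<in> C m \<longleftrightarrow> m = n) \<longrightarrow> g y = n" if "finite I" for I
    using that
  proof (induction I rule: finite_induct)
    case empty
    show ?case by (intro bexI[of _ "\<lambda>_. undefined"]) auto
  next
    case (insert k I)
    then obtain g where g: "g \<in> P \<rightarrow>\<^sub>M count_space UNIV"
      "\<And>y n. n \<in> I \<Longrightarrow> (\<forall>m. y \<in> C m \<longleftrightarrow> m = n) \<Longrightarrow> g y = n" by blast
    show ?case
    proof (intro bexI[of _ "\<lambda>y. if y \<in> C k then k else g y"] allI ballI impI)
      show "(\<lambda>y. if y \<in> C k then k else g y) \<in> P \<rightarrow>\<^sub>M count_space UNIV"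
        using g(1) C(1)[of k] by measurable
      show "(if y \<in> C k then k else g y) = n" if "n \<in> insert k I" "\<forall>m. y \<in> C m \<longleftrightarrow> m = n" for y n
        using that g(2)[of n y] by auto
    qed
  qed
  from this[OF finite_class.finite_UNIV]
  obtain g where g: "g \<in> P \<rightarrow>\<^sub>M count_space UNIV" "\<And>y n. (\<forall>m. y \<in> C m \<longleftrightarrow> m = n) \<Longrightarrow> g y = n" by blast
  show ?thesis
  proof (intro bexI[OF _ g(1)] ballI)
    fix \<omega> assume "\<omega> \<in> \<Omega>"
    then have "X \<omega> \<in> C m \<longleftrightarrow> m = a \<omega>" for m using C(2)[of m] by (auto simp: set_eq_iff)
    then show "a \<omega> = g (X \<omega>)" using g(2)[of "X \<omega>" "a \<omega>"] by simp
  qed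
qed

text \<open>Turns actions measurable in the history into a deterministic policy on transcripts. The
  runs agree at every point of the space and not just almost surely, which later lets the history be
  generated by a function of \<open>F\<close>.\<close>

lemma exists_policy_of_history:
  fixes F :: "'a \<Rightarrow> real ^ 'n" and A :: "nat \<Rightarrow> 'a \<Rightarrow> 'n"
  assumes first: "\<And>\<omega>. \<omega> \<in> space M \<Longrightarrow> A 1 \<omega> = a"
    and later: "\<And>t. t \<in> {1..<T} \<Longrightarrow> A (Suc t) \<in> history M F A t \<rightarrow>\<^sub>M count_space UNIV"
  obtains \<gamma> where "\<And>t. \<gamma> t \<in> transcript_space t \<rightarrow>\<^sub>M count_space UNIV"
    and "\<And>t \<omega>. t \<le> T \<Longrightarrow> \<omega> \<in> space M \<Longrightarrow>
        transcript \<gamma> t (F \<omega>) = (\<lambda>k\<in>{1..t}. (A k \<omega>, observation F A k \<omega>))"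
proof -
  let ?X = "\<lambda>t \<omega>. \<lambda>k\<in>{1..t}. (A k \<omega>, observation F A k \<omega>)"
  have X: "?X t \<in> space M \<rightarrow> space (transcript_space t)" for t
    by (intro funcsetI) (simp add: space_PiM space_pair_measure)
  define Q where "Q t g \<longleftrightarrow> g \<in> transcript_space t \<rightarrow>\<^sub>M count_space UNIV \<and>
      (t \<in> {1..<T} \<longrightarrow> (\<forall>\<omega>\<in>space M. A (Suc t) \<omega> = g (?X t \<omega>)))" for t and g :: "(nat \<Rightarrow> 'n \<times> real) \<Rightarrow> 'n"
  have "\<forall>t. \<exists>g. Q t g"
  proof
    fix t
    show "\<exists>g. Q t g"
    proof (cases "t \<in> {1..<T}")
      case True
      from measurable_vimage_algebra_factor[OF later[OF True, unfolded history_def] X]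
      obtain g where "g \<in> transcript_space t \<rightarrow>\<^sub>M count_space UNIV" "\<forall>\<omega>\<in>space M. A (Suc t) \<omega> = g (?X t \<omega>)" ..
      then show ?thesis unfolding Q_def by (intro exI[of _ g] conjI impI)
    next
      case False
      from False have "Q t (\<lambda>_. undefined)" by (simp add: Q_def del: atLeastLessThan_iff)
      then show ?thesis by (rule exI[of "Q t"])
    qed
  qed
  from choice[OF this] obtain g where Q: "\<forall>t. Q t (g t)" ..
  have g: "\<And>t. g t \<in> transcript_space t \<rightarrow>\<^sub>M count_space UNIV"
    "\<And>t \<omega>. t \<in> {1..<T} \<Longrightarrow> \<omega> \<in> space M \<Longrightarrow> A (Suc t) \<omega> = g t (?X t \<omega>)"
    using Q unfolding Q_def by simp_all
  \<comment> \<open>Index 0 is the choice before any observation, hence the constant first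
    action.\<close>
  define \<gamma> where "\<gamma> t = (if t = 0 then (\<lambda>_. a) else g t)" for t
  show ?thesis
  proof (rule that[of \<gamma>])
    show "\<gamma> t \<in> transcript_space t \<rightarrow>\<^sub>M count_space UNIV" for t
      using g(1) by (cases "t = 0") (simp_all add: \<gamma>_def)
    show "transcript \<gamma> t (F \<omega>) = ?X t \<omega>" if "t \<le> T" "\<omega> \<in> space M" for t \<omega>
      using that
    proof (induction t)
      case (Suc t)
      then have IH: "transcript \<gamma> t (F \<omega>) = ?X t \<omega>" by (meson Suc_leD)
      have "\<gamma> t (?X t \<omega>) = A (Suc t) \<omega>"
        using first[OF Suc.prems(2)] g(2)[of t \<omega>] Suc.prems by (cases "t = 0") (auto simp: \<gamma>_def)
      then show ?case unfolding transcript.simps IH by (auto simp: fun_eq_iff observation_def)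
    qed auto
  qed
qed

section \<open>Posterior moments as conditional expectations given the history\<close>

lemma measurable_transcript_arm:
  "k \<in> {1..t} \<Longrightarrow> (\<lambda>y. fst (y k)) \<in> transcript_space t \<rightarrow>\<^sub>M count_space UNIV"
  using measurable_component_singleton[of k "{1..t}" "\<lambda>_. count_space UNIV \<Otimes>\<^sub>M borel"]
  by (auto intro: measurable_compose[OF _ measurable_fst])

lemma measurable_transcript_value:
  "k \<in> {1..t} \<Longrightarrow> (\<lambda>y. snd (y k)) \<in> borel_measurable (transcript_space t)"
  using measurable_component_singleton[of k "{1..t}" "\<lambda>_. count_space UNIV \<Otimes>\<^sub>M borel"]
  by (auto intro: measurable_compose[OF _ measurable_snd])

lemma measurable_transcript_arms:
  "(\<lambda>y. (\<lambda>k. fst (y k)) ` {1..t}) \<in> transcript_space t \<rightarrow>\<^sub>M count_space (UNIV :: 'n::finite set set)"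
proof -
  have "J \<subseteq> {1..t} \<Longrightarrow>
    (\<lambda>y. (\<lambda>k. fst (y k)) ` J) \<in> transcript_space t \<rightarrow>\<^sub>M count_space (UNIV :: 'n set set)" if "finite J" for J
    using that
  proof (induction J rule: finite_induct)
    case (insert k J)
    have [measurable]: "(\<lambda>y. (\<lambda>k. fst (y k)) ` J) \<in> transcript_space t \<rightarrow>\<^sub>M count_space (UNIV :: 'n set set)"
      using insert by auto
    have "(\<lambda>y. fst (y k)) \<in> transcript_space t \<rightarrow>\<^sub>M count_space (UNIV :: 'n set)"
      using insert by (intro measurable_transcript_arm) auto
    then have "(\<lambda>y. insert (fst (y k)) ((\<lambda>k. fst (y k)) ` J)) \<in> transcript_space t \<rightarrow>\<^sub>M count_space (UNIV :: 'n set set)"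
      by (rule measurable_compose_countable[where f = "\<lambda>n y. insert n ((\<lambda>k. fst (y k)) ` J)", rotated]) measurable
    then show ?case by simp
  qed simp
  then show ?thesis by blast
qed

locale gaussian_bandit = gaussian_policy \<nu> S \<gamma> + M: prob_space M
  for \<nu> :: "(real ^ 'n) measure" and S \<gamma> and M :: "'a measure" +
  fixes F :: "'a \<Rightarrow> real ^ 'n" and A :: "nat \<Rightarrow> 'a \<Rightarrow> 'n" and T :: nat
  assumes F_measurable[measurable]: "F \<in> borel_measurable M"
    and distr_F: "distr M borel F = \<nu>"
    and transcript_F: "t \<le> T \<Longrightarrow> \<omega> \<in> space M \<Longrightarrow>
        transcript \<gamma> t (F \<omega>) = (\<lambda>k\<in>{1..t}. (A k \<omega>, observation F A k \<omega>))"
begin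

lemma integral_F: "h \<in> borel_measurable borel \<Longrightarrow> (\<integral>\<omega>. h (F \<omega>) \<partial>M) = (\<integral>f. h f \<partial>\<nu>)"
  for h :: "real ^ 'n \<Rightarrow> real"
  by (subst distr_F[symmetric], subst integral_distr) auto

lemma integrable_F: "integrable \<nu> h \<Longrightarrow> integrable M (\<lambda>\<omega>. h (F \<omega>))"
  for h :: "real ^ 'n \<Rightarrow> real"
  using integrable_distr[of F M borel h] distr_F by simp

lemma history_eq:
  assumes "t \<le> T"
  shows "history M F A t = vimage_algebra (space M) (\<lambda>\<omega>. transcript \<gamma> t (F \<omega>)) (transcript_space t)"
  unfolding history_def by (rule vimage_algebra_cong) (simp_all add: transcript_F assms)

lemma transcript_in_space: "transcript \<gamma> t f \<in> space (transcript_space t)"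
  using measurable_space[OF transcript_measurable, of f t] by simp

lemma subalgebra_history:
  assumes "t \<le> T"
  shows "subalgebra M (history M F A t)"
  unfolding subalgebra_def
proof
  show "space (history M F A t) = space M" by (simp add: history_def)
  show "sets (history M F A t) \<subseteq> sets M"
    unfolding history_eq[OF assms]
  proof (rule sets_image_in_sets')
    fix B :: "(nat \<Rightarrow> 'n \<times> real) set" assume "B \<in> sets (transcript_space t)"
    then show "(\<lambda>\<omega>. transcript \<gamma> t (F \<omega>)) -` B \<inter> space M \<in> sets M" 
      by (intro measurable_sets[OF measurable_compose[OF F_measurable transcript_measurable]])
  qed simp
qed

text \<open>The indicator of a history event is a function of the transcript, which resampling
  leaves unchanged. Hence \<open>integral_posterior\<close>, applied to \<open>h\<close> times this
  indicator, verifies the defining property of the conditional expectation.\<close>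

lemma real_cond_exp_history:
  fixes h :: "real ^ 'n \<Rightarrow> real"
  assumes t: "t \<le> T" and h: "integrable \<nu> h"
    and \<phi>[measurable]: "\<phi> \<in> borel_measurable (transcript_space t)"
    and eq: "\<And>f. \<phi> (transcript \<gamma> t f) = (\<integral>g. h (posterior t f g) \<partial>\<nu>)"
  shows "AE \<omega> in M. real_cond_exp M (history M F A t) (\<lambda>\<omega>. h (F \<omega>)) \<omega> = \<phi> (transcript \<gamma> t (F \<omega>))"
proof -
  have "finite_measure_subalgebra M (history M F A t)"
    using subalgebra_history[OF t] by unfold_locales
  then interpret H: finite_measure_subalgebra M "history M F A t" .
  have hm[measurable]: "h \<in> borel_measurable borel"
    using borel_measurable_integrable[OF h] by (simp add: measurable_cong_sets[OF sets_eq refl])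
  have \<phi>int: "integrable \<nu> (\<lambda>f. \<phi> (transcript \<gamma> t f))"
    unfolding eq by (rule integrable_integral_posterior[OF h])
  have into: "(\<lambda>\<omega>. transcript \<gamma> t (F \<omega>)) \<in> space M \<rightarrow> space (transcript_space t)"
    using transcript_in_space by auto
  show ?thesis
  proof (rule H.real_cond_exp_charact)
    fix B assume "B \<in> sets (history M F A t)"
    then obtain C where C[measurable]: "C \<in> sets (transcript_space t)"
      and B: "B = (\<lambda>\<omega>. transcript \<gamma> t (F \<omega>)) -` C \<inter> space M"
      unfolding history_eq[OF t] sets_vimage_algebra2[OF into] by blast
    let ?i = "\<lambda>f. indicator C (transcript \<gamma> t f) :: real"
    have iB: "indicator B \<omega> = ?i (F \<omega>)" if "\<omega> \<in> space M" for \<omega>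
      using that by (simp add: B indicator_def)
    have ih: "integrable \<nu> (\<lambda>f. ?i f * h f)"
      using h by (rule Bochner_Integration.integrable_bound) (auto simp: indicator_def)
    have "(\<integral>\<omega>\<in>B. h (F \<omega>) \<partial>M) = (\<integral>\<omega>. ?i (F \<omega>) * h (F \<omega>) \<partial>M)"
      unfolding set_lebesgue_integral_def
      by (intro Bochner_Integration.integral_cong) (simp_all add: iB)
    also have "\<dots> = (\<integral>f. ?i f * h f \<partial>\<nu>)" by (rule integral_F) measurable
    also have "\<dots> = (\<integral>f. \<integral>g. ?i f * h (posterior t f g) \<partial>\<nu> \<partial>\<nu>)"
      using integral_posterior[OF ih, of t] by simp
    also have "\<dots> = (\<integral>f. ?i f * \<phi> (transcript \<gamma> t f) \<partial>\<nu>)" by (simp add: eq)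
    also have "\<dots> = (\<integral>\<omega>. ?i (F \<omega>) * \<phi> (transcript \<gamma> t (F \<omega>)) \<partial>M)" by (rule integral_F[symmetric]) measurable
    also have "\<dots> = (\<integral>\<omega>\<in>B. \<phi> (transcript \<gamma> t (F \<omega>)) \<partial>M)"
      unfolding set_lebesgue_integral_def
      by (intro Bochner_Integration.integral_cong) (simp_all add: iB)
    finally show "(\<integral>\<omega>\<in>B. h (F \<omega>) \<partial>M) = (\<integral>\<omega>\<in>B. \<phi> (transcript \<gamma> t (F \<omega>)) \<partial>M)" .
  next
    show "integrable M (\<lambda>\<omega>. h (F \<omega>))" by (rule integrable_F[OF h])
    show "integrable M (\<lambda>\<omega>. \<phi> (transcript \<gamma> t (F \<omega>)))" by (rule integrable_F[OF \<phi>int])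
    show "(\<lambda>\<omega>. \<phi> (transcript \<gamma> t (F \<omega>))) \<in> borel_measurable (history M F A t)"
      unfolding history_eq[OF t]
      by (rule measurable_compose[OF measurable_vimage_algebra1[OF into] \<phi>])
  qed
qed

text \<open>Averaging the resampled arm removes the centred residual and leaves the regression. The
  work lies in exhibiting the regression as a measurable function of the transcript.\<close>

lemma AE_post_mean:
  assumes t: "t \<le> T"
  shows "AE \<omega> in M. post_mean M F A t n \<omega> = regr (seen \<gamma> t (F \<omega>)) n \<bullet> F \<omega>"
proof -
  define I where "I y = (\<lambda>k. fst (y k)) ` {1..t}" for y :: "nat \<Rightarrow> 'n \<times> real"
  text \<open>The value recorded for an arm, as the average over all times at which it was played.\<close>
  define v where "v y i = (\<Sum>k\<in>{1..t}. of_bool (fst (y k) = i) * snd (y k)) / (\<Sum>k\<in>{1..t}. of_bool (fst (y k) = i))"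
    for y :: "nat \<Rightarrow> 'n \<times> real" and i
  define \<phi> where "\<phi> y = (\<Sum>i\<in>UNIV. regr (I y) n $ i * v y i)" for y
  note [measurable] = measurable_transcript_arm measurable_transcript_value
  have I_meas: "I \<in> transcript_space t \<rightarrow>\<^sub>M count_space UNIV"
    unfolding I_def by (rule measurable_transcript_arms)
  have v_meas: "(\<lambda>y. v y i) \<in> borel_measurable (transcript_space t)" for i
    unfolding v_def by (intro borel_measurable_divide borel_measurable_sum borel_measurable_times) measurable
  have \<phi>_meas: "\<phi> \<in> borel_measurable (transcript_space t)"
    unfolding \<phi>_def
    by (rule measurable_compose_countable[OF _ I_meas, where f = "\<lambda>J y. \<Sum>i\<in>UNIV. regr J n $ i * v y i"])
      (intro borel_measurable_sum borel_measurable_times v_meas borel_measurable_const)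
  have I_tr: "I (transcript \<gamma> t f) = seen \<gamma> t f" for f by (simp add: I_def seen_eq_transcript)
  have v_tr: "v (transcript \<gamma> t f) i = f $ i" if i: "i \<in> seen \<gamma> t f" for f i
  proof -
    have "(\<Sum>k\<in>{1..t}. of_bool (act \<gamma> k f = i)) \<noteq> (0::real)"
      using i by (auto simp: sum_nonneg_eq_0_iff seen_def)
    moreover have "(\<Sum>k\<in>{1..t}. of_bool (act \<gamma> k f = i) * f $ act \<gamma> k f)
        = f $ i * (\<Sum>k\<in>{1..t}. of_bool (act \<gamma> k f = i))"
      unfolding sum_distrib_left by (rule sum.cong) auto
    moreover have "v (transcript \<gamma> t f) i = (\<Sum>k\<in>{1..t}. of_bool (act \<gamma> k f = i) * f $ act \<gamma> k f)
        / (\<Sum>k\<in>{1..t}. of_bool (act \<gamma> k f = i))"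
      unfolding v_def by (intro arg_cong2[where f = "(/)"] sum.cong) (auto simp: transcript_at)
    ultimately show ?thesis by simp
  qed
  have \<phi>_tr: "\<phi> (transcript \<gamma> t f) = regr (seen \<gamma> t f) n \<bullet> f" for f
  proof -
    have "\<phi> (transcript \<gamma> t f) = regr (seen \<gamma> t f) n \<bullet> (\<chi> i. v (transcript \<gamma> t f) i)"
      by (simp add: \<phi>_def I_tr inner_vec_def)
    also have "\<dots> = regr (seen \<gamma> t f) n \<bullet> f"
      by (rule regr_inner_cong) (simp add: v_tr)
    finally show ?thesis .
  qed
  have "integrable \<nu> (\<lambda>f. f $ n)" using integrable_inner[of "axis n 1"] by (simp add: inner_axis')
  moreover have "\<phi> (transcript \<gamma> t f) = (\<integral>g. posterior t f g $ n \<partial>\<nu>)" for f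
    by (simp add: \<phi>_tr resample_def prob_space[simplified])
  ultimately show ?thesis
    using real_cond_exp_history[OF t, of "\<lambda>f. f $ n", OF _ \<phi>_meas]
    by (simp add: \<phi>_tr post_mean_def)
qed

text \<open>After resampling, the deviation of an arm from its regression is the residual form of
  the fresh copy, whose second moment depends only on the set of arms seen.\<close>

lemma AE_post_cov:
  assumes t: "t \<le> T"
  shows "AE \<omega> in M. post_cov M F A t n n \<omega> = (sd (resid (seen \<gamma> t (F \<omega>)) n))\<^sup>2"
proof -
  have "(\<lambda>\<omega>. F \<omega> \<bullet> axis n 1) \<in> borel_measurable M" by measurable
  then have F_nth: "(\<lambda>\<omega>. F \<omega> $ n) \<in> borel_measurable M" by (simp add: inner_axis)
  define h where "h f = (f $ n - regr (seen \<gamma> t f) n \<bullet> f)\<^sup>2" for f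
  have h_resid: "h f = (resid (seen \<gamma> t f) n \<bullet> f)\<^sup>2" for f
    by (simp add: h_def resid_def inner_diff_left inner_axis')
  have [measurable]: "h \<in> borel_measurable borel"
    unfolding h_resid[abs_def]
    by (rule measurable_compose_countable[where f = "\<lambda>I f. (resid I n \<bullet> f)\<^sup>2"]) measurable
  have hF: "(\<lambda>\<omega>. h (F \<omega>)) \<in> borel_measurable M" by measurable
  have h_int: "integrable \<nu> h"
  proof (rule Bochner_Integration.integrable_bound)
    show "integrable \<nu> (\<lambda>f. \<Sum>I\<in>UNIV. (resid I n \<bullet> f)\<^sup>2)" by simp
    show "AE f in \<nu>. norm (h f) \<le> norm (\<Sum>I\<in>UNIV. (resid I n \<bullet> f)\<^sup>2)"
    proof (rule AE_I2)
      fix f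
      have "(resid (seen \<gamma> t f) n \<bullet> f)\<^sup>2 \<le> (\<Sum>I\<in>UNIV. (resid I n \<bullet> f)\<^sup>2)"
        by (rule member_le_sum) auto
      then show "norm (h f) \<le> norm (\<Sum>I\<in>UNIV. (resid I n \<bullet> f)\<^sup>2)"
        by (simp add: h_resid)
    qed
  qed simp
  define I where "I y = (\<lambda>k. fst (y k)) ` {1..t}" for y :: "nat \<Rightarrow> 'n \<times> real"
  define \<phi> where "\<phi> y = (sd (resid (I y) n))\<^sup>2" for y
  have I_meas[measurable]: "I \<in> transcript_space t \<rightarrow>\<^sub>M count_space UNIV"
    unfolding I_def by (rule measurable_transcript_arms)
  have \<phi>_meas: "\<phi> \<in> borel_measurable (transcript_space t)"
    unfolding \<phi>_def by measurable
  have \<phi>_tr: "\<phi> (transcript \<gamma> t f) = (sd (resid (seen \<gamma> t f) n))\<^sup>2" for f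
    by (simp add: \<phi>_def I_def seen_eq_transcript)
  have "h (posterior t f g) = (resid (seen \<gamma> t f) n \<bullet> g)\<^sup>2" for f g
  proof -
    have "seen \<gamma> t (posterior t f g) = seen \<gamma> t f" by (simp add: seen_eq_transcript[of _ _ "posterior t f g"]) (simp add: seen_eq_transcript)
    then show ?thesis by (simp add: h_def) (simp add: resample_def)
  qed
  then have "AE \<omega> in M. real_cond_exp M (history M F A t) (\<lambda>\<omega>. h (F \<omega>)) \<omega> = (sd (resid (seen \<gamma> t (F \<omega>)) n))\<^sup>2"
    using real_cond_exp_history[OF t h_int \<phi>_meas] by (simp add: \<phi>_tr integral_inner_sq)
  \<comment> \<open>\<open>post_mean\<close> is the regression only almost surely, so the integrand
    is replaced up to a null set.\<close>
  moreover have "AE \<omega> in M. post_cov M F A t n n \<omega> = real_cond_exp M (history M F A t) (\<lambda>\<omega>. h (F \<omega>)) \<omega>"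
  proof -
    have "finite_measure_subalgebra M (history M F A t)"
      using subalgebra_history[OF t] by unfold_locales
    then interpret H: finite_measure_subalgebra M "history M F A t" .
    have "post_mean M F A t n \<in> borel_measurable M"
      unfolding post_mean_def by measurable
    show ?thesis
      unfolding post_cov_def
    proof (rule H.real_cond_exp_cong)
      show "AE \<omega> in M. (F \<omega> $ n - post_mean M F A t n \<omega>) * (F \<omega> $ n - post_mean M F A t n \<omega>) = h (F \<omega>)"
        using AE_post_mean[OF t, of n] by eventually_elim (simp add: h_def power2_eq_square)
      show "(\<lambda>\<omega>. h (F \<omega>)) \<in> borel_measurable M" by (rule hF)
      show "(\<lambda>\<omega>. (F \<omega> $ n - post_mean M F A t n \<omega>) * (F \<omega> $ n - post_mean M F A t n \<omega>)) \<in> borel_measurable M"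
        by (intro borel_measurable_times borel_measurable_diff F_nth) fact+
    qed
  qed
  ultimately show ?thesis by eventually_elim simp
qed

end

section \<open>Growth of the observed range\<close>

context gaussian_policy
begin

definition obs :: "nat \<Rightarrow> real ^ 'n \<Rightarrow> real" where "obs k f = f $ act \<gamma> k f"
definition hi :: "nat \<Rightarrow> real ^ 'n \<Rightarrow> real" where "hi t f = Max ((\<lambda>k. obs k f) ` {1..t})"
definition lo :: "nat \<Rightarrow> real ^ 'n \<Rightarrow> real" where "lo t f = Min ((\<lambda>k. obs k f) ` {1..t})"
definition pmean :: "nat \<Rightarrow> real ^ 'n \<Rightarrow> 'n \<Rightarrow> real" where "pmean t f n = regr (seen \<gamma> t f) n \<bullet> f"
text \<open>The posterior standard deviation, not to be confused with the semidefiniteness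
  assumption of the same name.\<close>

definition psd :: "nat \<Rightarrow> real ^ 'n \<Rightarrow> 'n \<Rightarrow> real" where "psd t f n = sd (resid (seen \<gamma> t f) n)"

lemma psd_nonneg[simp]: "0 \<le> psd t f n" by (simp add: psd_def)

lemma integrable_component[simp]: "integrable \<nu> (\<lambda>f. f $ n)"
  using integrable_inner[of "axis n 1"] by (simp add: inner_axis')

lemma obs_measurable: "1 \<le> k \<Longrightarrow> obs k \<in> borel_measurable borel"
  unfolding obs_def
  by (cases k) (auto intro: measurable_compose_countable[where f = "\<lambda>n f. f $ n"])

lemma integrable_obs:
  assumes "1 \<le> k"
  shows "integrable \<nu> (obs k)"
proof (rule Bochner_Integration.integrable_bound)
  show "integrable \<nu> (\<lambda>f. \<Sum>n\<in>UNIV. \<bar>f $ n\<bar>)" by simp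
  show "obs k \<in> borel_measurable \<nu>"
    using obs_measurable[OF assms] by (simp add: measurable_cong_sets[OF sets_eq refl])
  show "AE f in \<nu>. norm (obs k f) \<le> norm (\<Sum>n\<in>UNIV. \<bar>f $ n\<bar>)"
  proof (rule AE_I2)
    fix f
    have "\<bar>f $ act \<gamma> k f\<bar> \<le> (\<Sum>n\<in>UNIV. \<bar>f $ n\<bar>)" by (rule member_le_sum) auto
    then show "norm (obs k f) \<le> norm (\<Sum>n\<in>UNIV. \<bar>f $ n\<bar>)" by (simp add: obs_def)
  qed
qed

lemma integrable_hi: "1 \<le> t \<Longrightarrow> integrable \<nu> (hi t)"
  unfolding hi_def by (rule integrable_Max_image) (auto intro!: integrable_obs)

lemma integrable_lo: "1 \<le> t \<Longrightarrow> integrable \<nu> (lo t)"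
  unfolding lo_def by (rule integrable_Min_image) (auto intro!: integrable_obs)

lemma hi_measurable: "1 \<le> t \<Longrightarrow> hi t \<in> borel_measurable borel"
  using borel_measurable_integrable[OF integrable_hi] by (simp add: measurable_cong_sets[OF sets_eq refl])

lemma lo_measurable: "1 \<le> t \<Longrightarrow> lo t \<in> borel_measurable borel"
  using borel_measurable_integrable[OF integrable_lo] by (simp add: measurable_cong_sets[OF sets_eq refl])

lemma
  assumes "1 \<le> t"
  shows hi_Suc: "hi (Suc t) f = max (hi t f) (obs (Suc t) f)"
    and lo_Suc: "lo (Suc t) f = min (lo t f) (obs (Suc t) f)"
  using assms by (simp_all add: hi_def lo_def atLeastAtMostSuc_conv max.commute min.commute)

lemma act_Suc_posterior: "act \<gamma> (Suc t) (posterior t f g) = act \<gamma> (Suc t) f"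
  by (simp add: act_Suc)

lemma obs_eq_transcript: "k \<in> {1..t} \<Longrightarrow> obs k f = snd (transcript \<gamma> t f k)"
  by (simp add: transcript_at obs_def)

lemma obs_posterior: "k \<in> {1..t} \<Longrightarrow> obs k (posterior t f g) = obs k f"
  by (simp only: obs_eq_transcript[of k t] transcript_posterior)

lemma
  shows hi_posterior: "hi t (posterior t f g) = hi t f"
    and lo_posterior: "lo t (posterior t f g) = lo t f"
  by (simp_all only: hi_def lo_def obs_posterior cong: image_cong)

lemma posterior_component: "posterior t f g $ n = pmean t f n + resid (seen \<gamma> t f) n \<bullet> g"
  by (simp add: resample_def pmean_def)

lemma integral_improvement:
  "(\<integral>g. max (m + r \<bullet> g - \<tau>) 0 \<partial>\<nu>) = ei \<tau> m (sd r)"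
  using integral_inner[of "\<lambda>y. max (m + y - \<tau>) 0" r] by (simp add: ei_eq_std)

lemma integrable_improvement: "integrable \<nu> (\<lambda>g. max (m + r \<bullet> g - \<tau>) 0)"
  by (intro integrable_max) auto

text \<open>Given the run, the next value is Gaussian with the posterior moments of the played arm.
  The range grows by the excess over the largest value plus the shortfall below the
  smallest.\<close>

lemma expected_range_increase:
  assumes "1 \<le> t"
  shows "(\<integral>g. (hi (Suc t) (posterior t f g) - lo (Suc t) (posterior t f g)) - (hi t (posterior t f g) - lo t (posterior t f g)) \<partial>\<nu>)
    = ei (hi t f) (pmean t f (act \<gamma> (Suc t) f)) (psd t f (act \<gamma> (Suc t) f))
    + ei (- lo t f) (- pmean t f (act \<gamma> (Suc t) f)) (psd t f (act \<gamma> (Suc t) f))"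
proof -
  let ?a = "act \<gamma> (Suc t) f" and ?m = "pmean t f (act \<gamma> (Suc t) f)"
  let ?r = "resid (seen \<gamma> t f) (act \<gamma> (Suc t) f)"
  have "(hi (Suc t) (posterior t f g) - lo (Suc t) (posterior t f g)) - (hi t (posterior t f g) - lo t (posterior t f g))
    = max (?m + ?r \<bullet> g - hi t f) 0 + max (- ?m + (- ?r) \<bullet> g - (- lo t f)) 0" for g
  proof -
    have "obs (Suc t) (posterior t f g) = ?m + ?r \<bullet> g"
      by (simp add: obs_def act_Suc_posterior posterior_component)
    then show ?thesis
      unfolding hi_Suc[OF assms] lo_Suc[OF assms] hi_posterior lo_posterior
      by (simp add: max_def min_def)
  qed
  then have "(\<integral>g. (hi (Suc t) (posterior t f g) - lo (Suc t) (posterior t f g)) - (hi t (posterior t f g) - lo t (posterior t f g)) \<partial>\<nu>)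
    = (\<integral>g. max (?m + ?r \<bullet> g - hi t f) 0 + max (- ?m + (- ?r) \<bullet> g - (- lo t f)) 0 \<partial>\<nu>)"
    by simp
  also have "\<dots> = (\<integral>g. max (?m + ?r \<bullet> g - hi t f) 0 \<partial>\<nu>) + (\<integral>g. max (- ?m + (- ?r) \<bullet> g - (- lo t f)) 0 \<partial>\<nu>)"
    by (intro Bochner_Integration.integral_add integrable_improvement)
  also have "\<dots> = ei (hi t f) ?m (psd t f ?a) + ei (- lo t f) (- ?m) (psd t f ?a)"
    unfolding integral_improvement by (simp add: psd_def)
  finally show ?thesis .
qed

definition arm_range :: "real ^ 'n \<Rightarrow> real" where
  "arm_range f = Max (range (\<lambda>n. f $ n)) - Min (range (\<lambda>n. f $ n))"

lemma integrable_Max_component: "integrable \<nu> (\<lambda>f. Max (range (\<lambda>n. f $ n)))"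
  by (rule integrable_Max_image) auto

lemma integrable_Min_component: "integrable \<nu> (\<lambda>f. Min (range (\<lambda>n. f $ n)))"
  by (rule integrable_Min_image) auto

lemma integrable_arm_range: "integrable \<nu> arm_range"
  unfolding arm_range_def
  by (intro Bochner_Integration.integrable_diff integrable_Max_component integrable_Min_component)

lemma integral_arm_range_nonneg: "0 \<le> (\<integral>f. arm_range f \<partial>\<nu>)"
  unfolding arm_range_def
proof (intro integral_nonneg_AE AE_I2)
  fix f :: "real ^ 'n"
  have "Min (range (\<lambda>n. f $ n)) \<le> f $ undefined" "f $ undefined \<le> Max (range (\<lambda>n. f $ n))" by simp_all
  then show "0 \<le> Max (range (\<lambda>n. f $ n)) - Min (range (\<lambda>n. f $ n))" by simp
qed

text \<open>By symmetry of the law, minus the minimum has the same expectation as the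
  maximum.\<close>

lemma integral_arm_range: "(\<integral>f. arm_range f \<partial>\<nu>) = 2 * (\<integral>f. Max (range (\<lambda>n. f $ n)) \<partial>\<nu>)"
proof -
  let ?mx = "\<lambda>f :: real ^ 'n. Max (range (\<lambda>n. f $ n))" and ?mn = "\<lambda>f :: real ^ 'n. Min (range (\<lambda>n. f $ n))"
  have mxm: "?mx \<in> borel_measurable borel"
    using borel_measurable_integrable[OF integrable_Max_component] by (simp add: measurable_cong_sets[OF sets_eq refl])
  have "(\<integral>f. ?mx f \<partial>\<nu>) = (\<integral>f. ?mx (- f) \<partial>\<nu>)"
    by (subst distr_uminus[symmetric], subst integral_distr) (use mxm in auto)
  also have "\<dots> = - (\<integral>f. ?mn f \<partial>\<nu>)"
  proof -
    have "?mx (- f) = - ?mn f" for f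
      unfolding vector_uminus_component by (rule Max_uminus_image) auto
    then show ?thesis by (simp only: Bochner_Integration.integral_minus)
  qed
  finally show ?thesis
    unfolding arm_range_def using integrable_Max_component integrable_Min_component by simp
qed

end

section \<open>One step of a sign-symmetric strategy\<close>

text \<open>The analysis of both strategies rests on an arm \<open>k\<close> that maximises the upper confidence
  bound, whether or not it is the arm \<open>n\<close> that is played.\<close>

definition ucb_dominating :: "real \<Rightarrow> (real \<Rightarrow> real \<Rightarrow> real \<Rightarrow> real \<Rightarrow> real) \<Rightarrow> 'n itself \<Rightarrow> bool" where
  "ucb_dominating s sc _ \<longleftrightarrow> (\<forall>h l (m :: 'n \<Rightarrow> real) \<sigma> n.
     (\<forall>j. 0 \<le> \<sigma> j) \<longrightarrow> is_arg_max (\<lambda>n. sc h l (m n) (\<sigma> n)) (\<lambda>_. True) n \<longrightarrow>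
     (\<exists>k. (\<forall>j. max (m j - h + \<sigma> j * s) (l - m j + \<sigma> j * s) \<le> max (m k - h + \<sigma> k * s) (l - m k + \<sigma> k * s)) \<and>
       max (ei h (m k) (\<sigma> k)) (ei (- l) (- m k) (\<sigma> k)) \<le> ei h (m n) (\<sigma> n) + ei (- l) (- m n) (\<sigma> n)))"

lemma ucb_dominatingE:
  fixes m \<sigma> :: "'n \<Rightarrow> real"
  assumes "ucb_dominating s sc TYPE('n)" and "\<And>j. 0 \<le> \<sigma> j"
    and "is_arg_max (\<lambda>n. sc h l (m n) (\<sigma> n)) (\<lambda>_. True) n"
  obtains k where
    "\<And>j. max (m j - h + \<sigma> j * s) (l - m j + \<sigma> j * s) \<le> max (m k - h + \<sigma> k * s) (l - m k + \<sigma> k * s)"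
    "max (ei h (m k) (\<sigma> k)) (ei (- l) (- m k) (\<sigma> k)) \<le> ei h (m n) (\<sigma> n) + ei (- l) (- m n) (\<sigma> n)"
proof -
  have "\<forall>j. 0 \<le> \<sigma> j" using assms(2) by simp
  from assms(1)[unfolded ucb_dominating_def, THEN spec[where x = h], THEN spec[where x = l],
      THEN spec[where x = m], THEN spec[where x = \<sigma>], THEN spec[where x = n], THEN mp, OF this, THEN mp, OF assms(3)]
  show ?thesis using that by blast
qed

text \<open>Here \<open>G\<close> is the posterior expected range, \<open>D\<close> the observed
  range and \<open>g\<close> the expected increase. The gain hypothesis is useful if its first
  factor \<open>x\<close> is nonnegative; otherwise the left-hand side is at most 0.\<close>

lemma step_arithmetic:
  fixes G D U :: real
  assumes G: "G \<le> (1 + \<delta>) * (D + 2 * U)" and U: "U = \<sigma> * s - w" and w: "2 * w \<le> D"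
    and level: "(1 + \<delta>) * (\<kappa> * s) \<le> s" and s: "0 < s" and \<kappa>: "0 \<le> \<kappa>" and c: "0 \<le> c" "2 * c \<le> P"
    and gain: "(\<sigma> * ((1 + \<delta>) * (\<kappa> * s)) - w) * P \<le> g" and g: "0 \<le> g"
  shows "c * (\<kappa> * G - D) \<le> g"
proof -
  define \<kappa>' where "\<kappa>' = (1 + \<delta>) * \<kappa>"
  have "\<kappa>' * s \<le> 1 * s" using level by (simp add: \<kappa>'_def mult.assoc)
  then have \<kappa>'1: "\<kappa>' \<le> 1" using s by simp
  define x where "x = \<sigma> * (\<kappa>' * s) - w"
  have "\<kappa> * G \<le> \<kappa>' * (D + 2 * U)"
    using mult_left_mono[OF G \<kappa>] by (simp add: \<kappa>'_def mult_ac)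
  \<comment> \<open>Lowering the level from \<open>s\<close> to \<open>\<kappa>' * s\<close> leaves
    a remainder of favourable sign, since \<open>\<kappa>' \<le> 1\<close> and
    \<open>2 * w \<le> D\<close>.\<close>
  moreover have "\<kappa>' * (D + 2 * U) - D = 2 * x - (1 - \<kappa>') * (D - 2 * w)"
    by (simp add: x_def U algebra_simps)
  moreover have "0 \<le> (1 - \<kappa>') * (D - 2 * w)" using \<kappa>'1 w by simp
  ultimately have "\<kappa> * G - D \<le> 2 * x" by linarith
  then have 1: "c * (\<kappa> * G - D) \<le> c * (2 * x)" using c(1) by (rule mult_left_mono)
  show ?thesis
  proof (cases "0 \<le> x")
    case True
    have "c * (2 * x) \<le> x * P" using mult_right_mono[OF c(2) True] by (simp add: mult_ac)
    also have "x * P \<le> g" using gain by (simp add: x_def \<kappa>'_def mult_ac)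
    finally show ?thesis using 1 by simp
  next
    case False
    then have "c * (2 * x) \<le> 0" using c(1) by (simp add: mult_nonneg_nonpos)
    then show ?thesis using 1 g by simp
  qed
qed

text \<open>\<open>sc\<close> is the acquisition as a function of the largest and smallest
  observation and of the mean and deviation of one arm. Measurability is asked for each fixed
  deviation, as posterior deviations are determined by the set of arms seen and so take finitely
  many values.\<close>

locale symmetric_strategy = gaussian_bandit \<nu> S \<gamma> M F A T
  for \<nu> :: "(real ^ 'n) measure" and S \<gamma> and M :: "'a measure" and F A T +
  fixes sel :: "'n set \<Rightarrow> 'n" and sc :: "real \<Rightarrow> real \<Rightarrow> real \<Rightarrow> real \<Rightarrow> real"
  assumes sel: "tie_breaking_rule sel"
    and sc_symmetric: "sc (- l) (- h) (- m) \<sigma> = sc h l m \<sigma>"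
    and sc_measurable: "0 \<le> \<sigma> \<Longrightarrow>
      (\<lambda>x. sc (fst x) (fst (snd x)) (snd (snd x)) \<sigma>) \<in> borel_measurable (borel \<Otimes>\<^sub>M borel \<Otimes>\<^sub>M borel)"
    and sc_dominating: "ucb_dominating (sqrt (2 * ln (real CARD('n)))) sc TYPE('n)"
    and strategy: "t \<in> {1..<T} \<Longrightarrow> AE \<omega> in M. A (Suc t) \<omega> = sel {n. is_arg_max
        (\<lambda>n. sc (max_obs F A t \<omega>) (min_obs F A t \<omega>) (post_mean M F A t n \<omega>) (sqrt (post_cov M F A t n n \<omega>)))
        (\<lambda>_. True) n}"
    and T: "500 \<le> T" "T \<le> CARD('n)"
begin

definition s :: real where "s = sqrt (2 * ln (real CARD('n)))"
definition L :: real where "L = sqrt (2 * (ln (real T) - ln (3 * ln (real T) powr (3/2))))"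
definition \<delta> :: real where "\<delta> = real CARD('n) * ei s 0 1 / s"

definition maximizers :: "nat \<Rightarrow> real ^ 'n \<Rightarrow> 'n set" where
  "maximizers t f = {n. is_arg_max (\<lambda>n. sc (hi t f) (lo t f) (pmean t f n) (psd t f n)) (\<lambda>_. True) n}"

lemma maximizers_nonempty: "maximizers t f \<noteq> {}"
proof -
  let ?g = "\<lambda>n. sc (hi t f) (lo t f) (pmean t f n) (psd t f n)"
  have "Max (range ?g) \<in> range ?g" by (rule Max_in) auto
  then obtain n where n: "Max (range ?g) = ?g n" by (rule rangeE)
  have "?g k \<le> ?g n" for k unfolding n[symmetric] by (rule Max_ge) auto
  then have "n \<in> maximizers t f" by (auto simp: maximizers_def is_arg_max_linorder)
  then show ?thesis by auto
qed

lemma obs_F: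
  assumes "k \<in> {1..T}" "\<omega> \<in> space M"
  shows "A k \<omega> = act \<gamma> k (F \<omega>)" "observation F A k \<omega> = obs k (F \<omega>)"
  using transcript_F[of T \<omega>] transcript_at[of k T \<gamma> "F \<omega>"] assms by (simp_all add: obs_def)

lemma
  assumes "t \<le> T" "\<omega> \<in> space M"
  shows max_obs_F: "max_obs F A t \<omega> = hi t (F \<omega>)" and min_obs_F: "min_obs F A t \<omega> = lo t (F \<omega>)"
  unfolding max_obs_def min_obs_def hi_def lo_def using assms
  by (auto intro!: arg_cong[where f = Max] arg_cong[where f = Min] image_cong obs_F)

text \<open>Serves to transport the almost sure choice from the probability space to \<nu>. As
  \<open>sel\<close> is an arbitrary function of sets, the event is split over the finitely many
  candidate sets \<open>J\<close>.\<close>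

lemma measurable_plays_maximizer:
  assumes t: "1 \<le> t"
  shows "Measurable.pred borel (\<lambda>f. act \<gamma> (Suc t) f = sel (maximizers t f))"
proof -
  note [measurable] = hi_measurable[OF t] lo_measurable[OF t]
  have g[measurable]: "(\<lambda>f. sc (hi t f) (lo t f) (pmean t f n) (psd t f n)) \<in> borel_measurable borel" for n
  proof -
    have "(\<lambda>f. sc (hi t f) (lo t f) (regr I n \<bullet> f) (sd (resid I n))) \<in> borel_measurable borel" for I
    proof -
      have "(\<lambda>f. (hi t f, lo t f, regr I n \<bullet> f)) \<in> borel \<rightarrow>\<^sub>M borel \<Otimes>\<^sub>M borel \<Otimes>\<^sub>M borel" by measurable
      from measurable_compose[OF this sc_measurable[OF sd_nonneg]] show ?thesis by simp
    qed
    then show ?thesis unfolding pmean_def psd_def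
      by (rule measurable_compose_countable[where g = "seen \<gamma> t"]) measurable
  qed
  have "(act \<gamma> (Suc t) f = sel (maximizers t f)) \<longleftrightarrow> (\<exists>J::'n set. act \<gamma> (Suc t) f = sel J \<and>
      (\<forall>n. n \<in> J \<longleftrightarrow> (\<forall>k. sc (hi t f) (lo t f) (pmean t f k) (psd t f k) \<le> sc (hi t f) (lo t f) (pmean t f n) (psd t f n))))" for f
  proof -
    have "(\<forall>n. n \<in> J \<longleftrightarrow> (\<forall>k. sc (hi t f) (lo t f) (pmean t f k) (psd t f k) \<le> sc (hi t f) (lo t f) (pmean t f n) (psd t f n)))
        \<longleftrightarrow> J = maximizers t f" for J
      by (auto simp: maximizers_def is_arg_max_linorder)
    then show ?thesis by auto
  qed
  then show ?thesis by simp
qed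

lemma AE_plays_maximizer:
  assumes "t \<in> {1..<T}"
  shows "AE f in \<nu>. act \<gamma> (Suc t) f = sel (maximizers t f)"
proof -
  have t: "t \<le> T" "Suc t \<in> {1..T}" "1 \<le> t" using assms by auto
  have "AE \<omega> in M. \<forall>n. post_mean M F A t n \<omega> = pmean t (F \<omega>) n"
    unfolding pmean_def by (subst AE_all_countable) (intro allI AE_post_mean t)
  moreover have "AE \<omega> in M. \<forall>n. post_cov M F A t n n \<omega> = (psd t (F \<omega>) n)\<^sup>2"
    unfolding psd_def by (subst AE_all_countable) (intro allI AE_post_cov t)
  ultimately have "AE \<omega> in M. act \<gamma> (Suc t) (F \<omega>) = sel (maximizers t (F \<omega>))"
    using strategy[OF assms] AE_space
  proof eventually_elim
    case (elim \<omega>)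
    then show ?case
      by (simp add: obs_F[OF t(2), symmetric] max_obs_F[OF t(1)] min_obs_F[OF t(1)] maximizers_def)
  qed
  then have "AE f in distr M borel F. act \<gamma> (Suc t) f = sel (maximizers t f)"
    using measurable_plays_maximizer[OF t(3)] by (subst AE_distr_iff) (simp_all add: pred_def)
  then show ?thesis by (simp only: distr_F)
qed

text \<open>Inductively, the sign change negates posterior means, keeps deviations and exchanges the
  two ends of the observed range. By \<open>sc_symmetric\<close> the set of maximizers is the same,
  and tie-breaking depends only on that set.\<close>

lemma AE_act_uminus: "AE f in \<nu>. \<forall>k\<in>{1..T}. act \<gamma> k (- f) = act \<gamma> k f"
proof -
  have 1: "AE f in \<nu>. \<forall>t\<in>{1..<T}. act \<gamma> (Suc t) f = sel (maximizers t f)"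
    using AE_plays_maximizer by (intro AE_finite_allI) auto
  \<comment> \<open>The sign change preserves \<nu>, so an almost sure statement also holds at
    \<open>- f\<close>.\<close>
  have "AE f in \<nu>. act \<gamma> (Suc t) (- f) = sel (maximizers t (- f))" if "t \<in> {1..<T}" for t
  proof (rule AE_distrD[where P = "\<lambda>f. act \<gamma> (Suc t) f = sel (maximizers t f)"])
    show "uminus \<in> \<nu> \<rightarrow>\<^sub>M borel" by simp
    show "AE f in distr \<nu> borel uminus. act \<gamma> (Suc t) f = sel (maximizers t f)"
      unfolding distr_uminus by (rule AE_plays_maximizer[OF that])
  qed
  then have "AE f in \<nu>. \<forall>t\<in>{1..<T}. act \<gamma> (Suc t) (- f) = sel (maximizers t (- f))"
    by (intro AE_finite_allI) auto
  with 1 show ?thesis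
  proof eventually_elim
    case (elim f)
    have "t \<le> T \<Longrightarrow> \<forall>k\<in>{1..t}. act \<gamma> k (- f) = act \<gamma> k f" for t
    proof (induction t)
      case (Suc t)
      then have IH: "act \<gamma> k (- f) = act \<gamma> k f" if "k \<in> {1..t}" for k using that by simp
      have "act \<gamma> (Suc t) (- f) = act \<gamma> (Suc t) f"
      proof (cases "t = 0")
        case True
        then show ?thesis by (simp add: act_Suc)
      next
        case False
        then have t: "t \<in> {1..<T}" using Suc.prems by auto
        have seen: "seen \<gamma> t (- f) = seen \<gamma> t f" unfolding seen_def by (rule image_cong) (simp_all add: IH)
        have obs: "(\<lambda>k. obs k (- f)) ` {1..t} = (\<lambda>k. - obs k f) ` {1..t}"
          by (rule image_cong) (simp_all add: IH obs_def)
        have "hi t (- f) = - lo t f"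
          unfolding hi_def lo_def obs by (rule Max_uminus_image) (use t in auto)
        moreover have "lo t (- f) = - hi t f"
          unfolding hi_def lo_def obs by (rule Min_uminus_image) (use t in auto)
        ultimately have "maximizers t (- f) = maximizers t f"
          by (simp add: maximizers_def pmean_def psd_def seen sc_symmetric)
        then show ?thesis using elim t by auto
      qed
      then show ?case using IH by (auto simp: le_Suc_eq)
    qed simp
    then show ?case by blast
  qed
qed

lemma integral_lo: "(\<integral>f. lo T f \<partial>\<nu>) = - (\<integral>f. hi T f \<partial>\<nu>)"
proof -
  have T1: "1 \<le> T" using T by simp
  have "(\<integral>f. hi T f \<partial>\<nu>) = (\<integral>f. hi T (- f) \<partial>\<nu>)"
    by (subst distr_uminus[symmetric], subst integral_distr) (use hi_measurable[OF T1] in auto)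
  also have "\<dots> = (\<integral>f. - lo T f \<partial>\<nu>)"
  proof (rule integral_cong_AE)
    have neg: "(uminus :: real ^ 'n \<Rightarrow> _) \<in> borel \<rightarrow>\<^sub>M borel" by simp
    show "(\<lambda>f. hi T (- f)) \<in> borel_measurable \<nu>"
      using measurable_compose[OF neg hi_measurable[OF T1]] by (simp add: measurable_cong_sets[OF sets_eq refl])
    show "(\<lambda>f. - lo T f) \<in> borel_measurable \<nu>"
      using lo_measurable[OF T1] by (simp add: measurable_cong_sets[OF sets_eq refl])
    show "AE f in \<nu>. hi T (- f) = - lo T f"
      using AE_act_uminus
    proof eventually_elim
      case (elim f)
      have "(\<lambda>k. obs k (- f)) ` {1..T} = (\<lambda>k. - obs k f) ` {1..T}"
        by (rule image_cong) (use elim in \<open>simp_all add: obs_def\<close>)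
      then show ?case unfolding hi_def lo_def
        by (simp only:) (rule Max_uminus_image, use T1 in auto)
    qed
  qed
  finally show ?thesis by simp
qed

text \<open>Half of the tail bound in \<open>tail_level_bounds\<close>. Over \<open>T - 1\<close>
  steps the rates add up to \<open>ln T / (2 * sqrt pi)\<close>, the logarithm of the power of
  \<open>T\<close> in the claim.\<close>

definition c :: real where "c = ln (real T) / (2 * sqrt pi * (real T - 1))"
definition \<kappa> :: real where "\<kappa> = L / s"

lemmas level = tail_level_bounds[OF T, folded s_def L_def, folded \<delta>_def]

lemma c_bounds: "0 \<le> c" "2 * c \<le> std_tail ((1 + \<delta>) * L)"
  using level(1) T by (auto simp: c_def)

lemma \<kappa>_bounds: "0 \<le> \<kappa>" "\<kappa> * s = L"
  using level by (auto simp: \<kappa>_def)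

lemma posterior_step:
  assumes t: "1 \<le> t" and play: "act \<gamma> (Suc t) f = sel (maximizers t f)"
  shows "c * (\<kappa> * (\<integral>g. arm_range (posterior t f g) \<partial>\<nu>) - (hi t f - lo t f))
    \<le> (\<integral>g. (hi (Suc t) (posterior t f g) - lo (Suc t) (posterior t f g)) - (hi t (posterior t f g) - lo t (posterior t f g)) \<partial>\<nu>)"
proof -
  let ?a = "act \<gamma> (Suc t) f" and ?h = "hi t f" and ?l = "lo t f" and ?m = "pmean t f" and ?\<sigma> = "psd t f"
  let ?U = "\<lambda>n. max (?m n - ?h + ?\<sigma> n * s) (?l - ?m n + ?\<sigma> n * s)"
  let ?gain = "ei ?h (?m ?a) (?\<sigma> ?a) + ei (- ?l) (- ?m ?a) (?\<sigma> ?a)"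
  have "?a \<in> maximizers t f"
    using sel maximizers_nonempty[of t f] play by (simp add: tie_breaking_rule_def)
  then have arg: "is_arg_max (\<lambda>n. sc ?h ?l (?m n) (?\<sigma> n)) (\<lambda>_. True) ?a" by (simp add: maximizers_def)
  obtain k where k: "\<And>j. ?U j \<le> ?U k"
    and gain: "max (ei ?h (?m k) (?\<sigma> k)) (ei (- ?l) (- ?m k) (?\<sigma> k)) \<le> ?gain"
    by (rule ucb_dominatingE[OF sc_dominating[folded s_def] psd_nonneg arg]) (rule that)
  \<comment> \<open>The signed distance from the posterior mean to the nearer end of the observed
    range; the two distances add up to that range, whence
    \<open>2 * w \<le> ?h - ?l\<close>.\<close>
  define w where "w = min (?h - ?m k) (?m k - ?l)"
  have Uw: "?U k = ?\<sigma> k * s - w" by (auto simp: w_def max_def min_def)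
  \<comment> \<open>The tail bound is applied in the direction of the nearer end.\<close>
  have "(?\<sigma> k * x - w) * std_tail x \<le> max (ei ?h (?m k) (?\<sigma> k)) (ei (- ?l) (- ?m k) (?\<sigma> k))" for x
    using ei_ge_tail[of "?\<sigma> k" x ?h "?m k"] ei_ge_tail[of "?\<sigma> k" x "- ?l" "- ?m k"]
    by (cases "?h - ?m k \<le> ?m k - ?l") (auto simp: w_def min_def)
  from order_trans[OF this gain]
  have gain': "(?\<sigma> k * ((1 + \<delta>) * (\<kappa> * s)) - w) * std_tail ((1 + \<delta>) * L) \<le> ?gain"
    by (simp only: \<kappa>_bounds)
  have range: "(\<integral>g. arm_range (posterior t f g) \<partial>\<nu>) \<le> (1 + \<delta>) * (?h - ?l + 2 * ?U k)"
    unfolding arm_range_def posterior_component \<delta>_def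
  proof (rule expected_range_le)
    show "?m n - ?h + sd (resid (seen \<gamma> t f) n) * s \<le> ?U k" for n
      using k[of n] by (simp add: psd_def)
    show "?l - ?m n + sd (resid (seen \<gamma> t f) n) * s \<le> ?U k" for n
      using k[of n] by (simp add: psd_def)
  qed (rule level(5))
  have "c * (\<kappa> * (\<integral>g. arm_range (posterior t f g) \<partial>\<nu>) - (?h - ?l)) \<le> ?gain"
  proof (rule step_arithmetic[OF range Uw _ _ level(5) \<kappa>_bounds(1) c_bounds gain'])
    show "2 * w \<le> ?h - ?l" by (auto simp: w_def min_def)
    show "(1 + \<delta>) * (\<kappa> * s) \<le> s" using level(2) by (simp only: \<kappa>_bounds)
    show "0 \<le> ?gain" by (intro add_nonneg_nonneg ei_nonneg)
  qed
  then show ?thesis by (simp only: expected_range_increase[OF t])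
qed

definition d :: "nat \<Rightarrow> real" where "d t = (\<integral>f. hi t f - lo t f \<partial>\<nu>)"

text \<open>Integrates \<open>posterior_step\<close>; the tower property turns both posterior
  expectations into prior ones.\<close>

lemma d_step:
  assumes "t \<in> {1..<T}"
  shows "c * (\<kappa> * (\<integral>f. arm_range f \<partial>\<nu>) - d t) \<le> d (Suc t) - d t"
proof -
  have t: "1 \<le> t" using assms by simp
  let ?inc = "\<lambda>f. (hi (Suc t) f - lo (Suc t) f) - (hi t f - lo t f)"
  have iD: "integrable \<nu> (\<lambda>f. hi u f - lo u f)" if "1 \<le> u" for u
    using integrable_hi[OF that] integrable_lo[OF that] by simp
  have iI: "integrable \<nu> ?inc" using iD[OF t] iD[of "Suc t"] by simp
  have iR: "integrable \<nu> (\<lambda>f. \<integral>g. arm_range (posterior t f g) \<partial>\<nu>)"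
    by (rule integrable_integral_posterior[OF integrable_arm_range])
  have "c * (\<kappa> * (\<integral>f. arm_range f \<partial>\<nu>) - d t)
      = (\<integral>f. c * (\<kappa> * (\<integral>g. arm_range (posterior t f g) \<partial>\<nu>) - (hi t f - lo t f)) \<partial>\<nu>)"
    using iR iD[OF t] by (simp add: integral_posterior[OF integrable_arm_range] d_def)
  also have "\<dots> \<le> (\<integral>f. \<integral>g. ?inc (posterior t f g) \<partial>\<nu> \<partial>\<nu>)"
  proof (rule integral_mono_AE)
    show "integrable \<nu> (\<lambda>f. c * (\<kappa> * (\<integral>g. arm_range (posterior t f g) \<partial>\<nu>) - (hi t f - lo t f)))"
      using iR iD[OF t] by simp
    show "integrable \<nu> (\<lambda>f. \<integral>g. ?inc (posterior t f g) \<partial>\<nu>)"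
      by (rule integrable_integral_posterior[OF iI])
    show "AE f in \<nu>. c * (\<kappa> * (\<integral>g. arm_range (posterior t f g) \<partial>\<nu>) - (hi t f - lo t f))
        \<le> (\<integral>g. ?inc (posterior t f g) \<partial>\<nu>)"
      using AE_plays_maximizer[OF assms] by eventually_elim (rule posterior_step[OF t])
  qed
  also have "\<dots> = (\<integral>f. ?inc f \<partial>\<nu>)" by (rule integral_posterior[OF iI])
  also have "\<dots> = d (Suc t) - d t"
    unfolding d_def using iD[OF t] iD[of "Suc t"] by (intro Bochner_Integration.integral_diff) auto
  finally show ?thesis .
qed

theorem expected_best_observation:
  "(1 - real T powr (- (1 / (2 * sqrt pi)))) * \<kappa> * (\<integral>f. Max (range (\<lambda>n. f $ n)) \<partial>\<nu>) \<le> (\<integral>f. hi T f \<partial>\<nu>)"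
proof -
  define R where "R = (\<integral>f. arm_range f \<partial>\<nu>)"
  have R0: "0 \<le> R" unfolding R_def by (rule integral_arm_range_nonneg)
  have T1: "1 \<le> T" using T by simp
  have c1: "c \<le> 1" using c_bounds std_tail_bounds(2)[of "(1 + \<delta>) * L"] by linarith
  have "t \<le> T \<Longrightarrow> 1 \<le> t \<Longrightarrow> \<kappa> * R - d t \<le> (1 - c) ^ (t - 1) * (\<kappa> * R)" for t
  proof (induction t)
    case (Suc t)
    show ?case
    proof (cases "t = 0")
      case True
      \<comment> \<open>A single observation has range 0, so the recursion starts at time 1 with the
        full gap.\<close>
      then show ?thesis by (simp add: d_def hi_def lo_def)
    next
      case False
      then have t: "t \<in> {1..<T}" using Suc.prems by auto
      have "\<kappa> * R - d (Suc t) \<le> (1 - c) * (\<kappa> * R - d t)"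
        using d_step[OF t] by (simp add: R_def algebra_simps)
      also have "\<dots> \<le> (1 - c) * ((1 - c) ^ (t - 1) * (\<kappa> * R))"
        using Suc t c1 by (intro mult_left_mono) auto
      also have "\<dots> = (1 - c) ^ (Suc t - 1) * (\<kappa> * R)"
        using False by (cases t) simp_all
      finally show ?thesis .
    qed
  qed simp
  from this[OF order_refl T1]
  have 1: "\<kappa> * R - d T \<le> (1 - c) ^ (T - 1) * (\<kappa> * R)" .
  have "(1 - c) ^ (T - 1) \<le> exp (- c) ^ (T - 1)"
    using c1 exp_ge_add_one_self[of "- c"] by (intro power_mono) auto
  also have "\<dots> = exp (- (c * (real T - 1)))"
    using T1 by (simp add: exp_of_nat_mult[symmetric] of_nat_diff mult.commute)
  also have "c * (real T - 1) = ln (real T) * (1 / (2 * sqrt pi))"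
    using T by (simp add: c_def)
  also have "exp (- (ln (real T) * (1 / (2 * sqrt pi)))) = real T powr (- (1 / (2 * sqrt pi)))"
    using T by (simp add: powr_def mult.commute)
  finally have "(1 - c) ^ (T - 1) * (\<kappa> * R) \<le> real T powr (- (1 / (2 * sqrt pi))) * (\<kappa> * R)"
    using R0 \<kappa>_bounds(1) by (intro mult_right_mono) auto
  with 1 have "(1 - real T powr (- (1 / (2 * sqrt pi)))) * \<kappa> * R \<le> d T"
    by (simp add: algebra_simps)
  moreover have "d T = 2 * (\<integral>f. hi T f \<partial>\<nu>)"
    unfolding d_def using integrable_hi[OF T1] integrable_lo[OF T1] by (simp add: integral_lo)
  ultimately show ?thesis by (simp add: R_def integral_arm_range)
qed

end

section \<open>The two strategies\<close>

lemma measurable_ei: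
  assumes "0 \<le> \<sigma>" and [measurable]: "\<tau> \<in> borel_measurable M" "m \<in> borel_measurable M"
  shows "(\<lambda>x. ei (\<tau> x) (m x) \<sigma>) \<in> borel_measurable M"
proof -
  interpret prob_space std_normal_distribution
    by (rule prob_space_normal_density) simp
  show ?thesis unfolding ei_eq_std[OF assms(1)] by measurable
qed

text \<open>The witness is any arm of largest upper confidence bound; the arm played has at least
  its acquisition value, and a maximum of two nonnegative terms is at most their sum.\<close>

lemma ei2_ucb_dominating:
  "ucb_dominating s (\<lambda>h l m \<sigma>. max (ei h m \<sigma>) (ei (- l) (- m) \<sigma>)) TYPE('n::finite)"
  unfolding ucb_dominating_def
proof (intro allI impI)
  fix h l :: real and m \<sigma> :: "'n \<Rightarrow> real" and n
  assume "is_arg_max (\<lambda>n. max (ei h (m n) (\<sigma> n)) (ei (- l) (- m n) (\<sigma> n))) (\<lambda>_. True) n"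
  then have n: "max (ei h (m k) (\<sigma> k)) (ei (- l) (- m k) (\<sigma> k)) \<le> max (ei h (m n) (\<sigma> n)) (ei (- l) (- m n) (\<sigma> n))" for k
    by (simp add: is_arg_max_linorder)
  let ?U = "\<lambda>j. max (m j - h + \<sigma> j * s) (l - m j + \<sigma> j * s)"
  have "Max (range ?U) \<in> range ?U" by (rule Max_in) auto
  then obtain k where k: "Max (range ?U) = ?U k" by (rule rangeE)
  have "?U j \<le> ?U k" for j unfolding k[symmetric] by (rule Max_ge) auto
  moreover have "max (ei h (m n) (\<sigma> n)) (ei (- l) (- m n) (\<sigma> n)) \<le> ei h (m n) (\<sigma> n) + ei (- l) (- m n) (\<sigma> n)"
    using ei_nonneg[of h "m n" "\<sigma> n"] ei_nonneg[of "- l" "- m n" "\<sigma> n"] by simp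
  ultimately show "\<exists>k. (\<forall>j. ?U j \<le> ?U k) \<and>
      max (ei h (m k) (\<sigma> k)) (ei (- l) (- m k) (\<sigma> k)) \<le> ei h (m n) (\<sigma> n) + ei (- l) (- m n) (\<sigma> n)"
    using n[of k] by (intro exI[of _ k] conjI allI) (blast, linarith)
qed

text \<open>The arm played is itself the witness.\<close>

lemma ucb2_ucb_dominating:
  "ucb_dominating s (\<lambda>h l m \<sigma>. max (- h + m + \<sigma> * s) (l - m + \<sigma> * s)) TYPE('n::finite)"
  unfolding ucb_dominating_def
proof (intro allI impI)
  fix h l :: real and m \<sigma> :: "'n \<Rightarrow> real" and n
  let ?U = "\<lambda>j. max (m j - h + \<sigma> j * s) (l - m j + \<sigma> j * s)"
  assume "is_arg_max (\<lambda>n. max (- h + m n + \<sigma> n * s) (l - m n + \<sigma> n * s)) (\<lambda>_. True) n"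
  then have "?U k \<le> ?U n" for k by (simp add: is_arg_max_linorder add.commute)
  moreover have "max (ei h (m n) (\<sigma> n)) (ei (- l) (- m n) (\<sigma> n)) \<le> ei h (m n) (\<sigma> n) + ei (- l) (- m n) (\<sigma> n)"
    using ei_nonneg[of h "m n" "\<sigma> n"] ei_nonneg[of "- l" "- m n" "\<sigma> n"] by simp
  ultimately show "\<exists>k. (\<forall>j. ?U j \<le> ?U k) \<and>
      max (ei h (m k) (\<sigma> k)) (ei (- l) (- m k) (\<sigma> k)) \<le> ei h (m n) (\<sigma> n) + ei (- l) (- m n) (\<sigma> n)"
    by blast
qed

theorem corollary1:
  fixes N T :: nat
    and M :: "'a measure"
    and F :: "'a \<Rightarrow> real ^ 'n"
    and S :: "real ^ 'n ^ 'n"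
    and A :: "nat \<Rightarrow> 'a \<Rightarrow> 'n"
    and sel :: "'n set \<Rightarrow> 'n"
  defines "EFmax \<equiv> prob_space.expectation M (\<lambda>\<omega>. Max (range (\<lambda>n. F \<omega> $ n)))"
    and "EYmax \<equiv> prob_space.expectation M (\<lambda>\<omega>. max_obs F A T \<omega>)"
  assumes "prob_space M"
    and "CARD('n) = N" and "N \<ge> T" and "T \<ge> 500"
    and "transpose S = S" and "\<forall>x. x \<bullet> (S *v x) \<ge> 0"
    and "gaussian_vector M F 0 S"
    and "EFmax \<noteq> 0"
    and "tie_breaking_rule sel"
    and "follows_ei2 sel M F T A \<or> follows_ucb2 sel M F T A"
  shows "(EFmax - EYmax) / EFmax
       \<le> 1 - (1 - real T powr (- (1 / (2 * sqrt pi))))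
             * sqrt ((ln (real T) - ln (3 * ln (real T) powr (3/2))) / ln (real N))"
proof -
  interpret M: prob_space M by fact
  define s where "s = sqrt (2 * ln (real CARD('n)))"
  define \<kappa> where "\<kappa> = sqrt ((ln (real T) - ln (3 * ln (real T) powr (3/2))) / ln (real N))"
  have F[measurable]: "F \<in> borel_measurable M"
    and lin: "distr M borel (\<lambda>\<omega>. u \<bullet> F \<omega>) = normal_measure 0 (sqrt (u \<bullet> (S *v u)))" for u
    using \<open>gaussian_vector M F 0 S\<close> by (simp_all add: gaussian_vector_def)
  define \<nu> where "\<nu> = distr M borel F"
  have "centered_gaussian \<nu> S"
    unfolding centered_gaussian_def centered_gaussian_axioms_def
  proof (intro conjI allI)
    show "prob_space \<nu>" unfolding \<nu>_def by (rule M.prob_space_distr) (rule F)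
    show "distr \<nu> borel (\<lambda>f. u \<bullet> f) = normal_measure 0 (sqrt (u \<bullet> (S *v u)))" for u
      unfolding \<nu>_def by (subst distr_distr) (simp_all add: comp_def lin)
  qed (use assms in \<open>auto simp: \<nu>_def\<close>)
  define sc where "sc = (if follows_ei2 sel M F T A then (\<lambda>h l m \<sigma>. max (ei h m \<sigma>) (ei (- l) (- m) \<sigma>))
    else (\<lambda>h l m \<sigma>. max (- h + m + \<sigma> * s) (l - m + \<sigma> * s)))"
  have follows: "follows_strategy (\<lambda>t \<omega> n. sc (max_obs F A t \<omega>) (min_obs F A t \<omega>) (post_mean M F A t n \<omega>)
      (sqrt (post_cov M F A t n n \<omega>))) sel M F T A"
  proof (cases "follows_ei2 sel M F T A")
    case True
    then show ?thesis
      unfolding sc_def follows_ei2_def ei2_acquisition_def[abs_def] by simp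
  next
    case False
    then have "follows_ucb2 sel M F T A" using assms by simp
    then show ?thesis using False
      unfolding sc_def follows_ucb2_def ucb2_acquisition_def[abs_def] s_def
      by (simp add: real_sqrt_mult mult.assoc)
  qed
  then obtain a where "\<forall>\<omega>\<in>space M. A 1 \<omega> = a"
    unfolding follows_strategy_def by blast
  then have a: "\<And>\<omega>. \<omega> \<in> space M \<Longrightarrow> A 1 \<omega> = a" by blast
  have later: "\<And>t. t \<in> {1..<T} \<Longrightarrow> A (Suc t) \<in> history M F A t \<rightarrow>\<^sub>M count_space UNIV"
    and strategy: "\<And>t. t \<in> {1..<T} \<Longrightarrow> AE \<omega> in M. A (Suc t) \<omega> = sel {n. is_arg_max
        (\<lambda>n. sc (max_obs F A t \<omega>) (min_obs F A t \<omega>) (post_mean M F A t n \<omega>) (sqrt (post_cov M F A t n n \<omega>)))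
        (\<lambda>_. True) n}"
    using follows unfolding follows_strategy_def by blast+
  obtain \<gamma> where \<gamma>: "\<And>t. \<gamma> t \<in> transcript_space t \<rightarrow>\<^sub>M count_space UNIV"
    and tr: "\<And>t \<omega>. t \<le> T \<Longrightarrow> \<omega> \<in> space M \<Longrightarrow>
        transcript \<gamma> t (F \<omega>) = (\<lambda>k\<in>{1..t}. (A k \<omega>, observation F A k \<omega>))"
    by (rule exists_policy_of_history[of M A a T F, OF a later]) (assumption | rule that)+
  have "gaussian_bandit \<nu> S \<gamma> M F A T"
    by (intro gaussian_bandit.intro gaussian_policy.intro gaussian_policy_axioms.intro gaussian_bandit_axioms.intro)
      (fact | rule \<gamma> tr | simp add: \<nu>_def)+
  then interpret B: gaussian_bandit \<nu> S \<gamma> M F A T .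
  have "symmetric_strategy \<nu> S \<gamma> M F A T sel sc"
  proof (intro symmetric_strategy.intro symmetric_strategy_axioms.intro)
    show "sc (- l) (- h) (- m) \<sigma> = sc h l m \<sigma>" for h l m \<sigma>
      by (simp add: sc_def max.commute algebra_simps)
    show "(\<lambda>x. sc (fst x) (fst (snd x)) (snd (snd x)) \<sigma>) \<in> borel_measurable (borel \<Otimes>\<^sub>M borel \<Otimes>\<^sub>M borel)"
      if "0 \<le> \<sigma>" for \<sigma>
    proof (cases "follows_ei2 sel M F T A")
      case True
      then show ?thesis
        by (simp only: sc_def if_True) (intro borel_measurable_max measurable_ei[OF that], measurable)
    next
      case False
      then show ?thesis by (simp only: sc_def if_False) measurable
    qed
    show "ucb_dominating (sqrt (2 * ln (real CARD('n)))) sc TYPE('n)"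
      unfolding sc_def s_def[symmetric] by (cases "follows_ei2 sel M F T A")
        (simp_all only: if_True if_False ei2_ucb_dominating ucb2_ucb_dominating)
  qed (use assms strategy B.gaussian_bandit_axioms in auto)
  then interpret St: symmetric_strategy \<nu> S \<gamma> M F A T sel sc .
  have T1: "1 \<le> T" using assms by simp
  have EF: "EFmax = (\<integral>f. Max (range (\<lambda>n. f $ n)) \<partial>\<nu>)"
    unfolding EFmax_def using borel_measurable_integrable[OF B.integrable_Max_component]
    by (intro B.integral_F) (simp add: measurable_cong_sets[OF B.sets_eq refl])
  have EY: "EYmax = (\<integral>f. B.hi T f \<partial>\<nu>)"
  proof -
    have "EYmax = (\<integral>\<omega>. B.hi T (F \<omega>) \<partial>M)"
      unfolding EYmax_def by (intro Bochner_Integration.integral_cong refl St.max_obs_F order_refl)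
    then show ?thesis using B.integral_F[OF B.hi_measurable[OF T1]] by simp
  qed
  \<comment> \<open>Twice the expected maximum is an expected range, so a nonzero
    \<open>EFmax\<close> is positive and division by it preserves inequalities.\<close>
  have "0 \<le> 2 * EFmax"
    unfolding EF B.integral_arm_range[symmetric] by (rule B.integral_arm_range_nonneg)
  with \<open>EFmax \<noteq> 0\<close> have pos: "0 < EFmax" by simp
  \<comment> \<open>The factors 2 under the two roots cancel.\<close>
  have "St.\<kappa> = \<kappa>"
    unfolding St.\<kappa>_def St.L_def St.s_def \<kappa>_def using \<open>CARD('n) = N\<close>
    by (simp only: real_sqrt_divide[symmetric] mult_divide_mult_cancel_left_if) simp
  then have "(1 - real T powr (- (1 / (2 * sqrt pi)))) * \<kappa> * EFmax \<le> EYmax"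
    using St.expected_best_observation by (simp add: EF EY)
  then have "(1 - real T powr (- (1 / (2 * sqrt pi)))) * \<kappa> \<le> EYmax / EFmax"
    using pos by (simp add: pos_le_divide_eq)
  moreover have "(EFmax - EYmax) / EFmax = 1 - EYmax / EFmax"
    using pos by (simp add: diff_divide_distrib)
  ultimately show ?thesis by (simp add: \<kappa>_def)
qed

end
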